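(* Let $(\gamma_n)_{n\ge 1}$ be a sequence with $\gamma_n\in(-1/2,1/2)$ for all $n$, and let $\nu=\prod_{n=1}^{\infty}\nu_n$ be the product measure on $\{-1,1\}^{\mathbb{N}}$ with $\nu_n(\{1\})=\frac12+\gamma_n$ and $\nu_n(\{-1\})=\frac12-\gamma_n$. (1) If there is $\delta>0$ such that $\gamma_n=O\bigl((\log n)^{-(1/2+\delta)}\bigr)$ as $n\to\infty$, then $\nu$-almost every $x\in\{-1,1\}^{\mathbb{N}}$ is simply Poisson generic. (2) If there is $\delta>0$ such that $\gamma_n=(\log n)^{-(1/2-\delta)}$ for all sufficiently large $n$, then $\nu$-almost every $x\in\{-1,1\}^{\mathbb{N}}$ is not simply Poisson generic.
   Context: $\mathbb{N}=\{1,2,3,\dots\}$ and $\log^{-c}n$ means $(\log n)^{-c}$. For $x\in\{-1,1\}^{\mathbb{N}}$ and $k\ge1$, let $W_k$ be a uniformly distributed random word in $\{-1,1\}^k$ and let $M_k^x=\#\{1\le j\le 2^k : x_j x_{j+1}\cdots x_{j+k-1}=W_k\}$, a random variable whose randomness comes only from $W_k$. The point $x$ is called simply Poisson generic if $M_k^x$ converges in distribution, as $k\to\infty$, to a Poisson random variable with mean one, i.e. $\lim_{k\to\infty}\mathbb{P}(M_k^x=n)=\frac{1}{e\, n!}$ for every integer $n\ge0$. *)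

theory Defs
  imports "HOL-Probability.Probability" "HOL-Library.Landau_Symbols"
begin

definition sign_measure :: "real \<Rightarrow> int measure" where
  "sign_measure g =
     point_measure {-1, 1} (\<lambda>s. ennreal (if s = 1 then 1/2 + g else 1/2 - g))"

text \<open>
  The index set of the sequences is \<open>{1..}\<close>; points of this space are functions on \<^typ>\<open>nat\<close>
  that take values in \<open>{-1, 1}\<close> on \<open>{1..}\<close> and the dummy value \<^const>\<open>undefined\<close> at \<open>0\<close>.
\<close>

definition sign_product :: "(nat \<Rightarrow> real) \<Rightarrow> (nat \<Rightarrow> int) measure" where
  "sign_product \<gamma> = (\<Pi>\<^sub>M n\<in>{1..}. sign_measure (\<gamma> n))"

definition sign_words :: "nat \<Rightarrow> int list set" where
  "sign_words k = {w. set w \<subseteq> {-1, 1} \<and> length w = k}"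

definition occurrences :: "(nat \<Rightarrow> int) \<Rightarrow> nat \<Rightarrow> int list \<Rightarrow> nat" where
  "occurrences x k w = card {j \<in> {1..2 ^ k}. map x [j..<j + k] = w}"

definition simply_poisson_generic :: "(nat \<Rightarrow> int) \<Rightarrow> bool" where
  "simply_poisson_generic x \<longleftrightarrow>
     (\<forall>n. (\<lambda>k. measure_pmf.prob (pmf_of_set (sign_words k)) {w. occurrences x k w = n})
            \<longlonglongrightarrow> 1 / (exp 1 * fact n))"

end

theory Submission
  imports Defs
begin

text \<open>
  Part (1). Given the word \<open>w\<close>, the count of \<open>w\<close> is a sum of locally dependent indicators, so Stein's
  equation for the Poisson law compares it with Poisson(1), up to the deviation of its mean from 1 and
  the correlations of neighbouring windows. Averaged over all words these errors vanish: the second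
  moment of the mean is a sum of products of \<open>k\<close> factors \<open>1 + 4 * \<gamma> i * \<gamma> j\<close>, which is close to 1
  because \<open>k * (\<gamma> n)\<^sup>2\<close> tends to 0 at the scale \<open>ln n \<approx> k\<close> (the windows starting before
  \<open>2 ^ (k div 2)\<close> meet too few words to matter), and at most one word occupies two given windows.
  Changing one coordinate affects at most \<open>2 * k\<close> of the \<open>2 ^ k\<close> words, so by the Efron--Stein
  inequality the fraction of words occurring \<open>n\<close> times has summable variance, and the convergence of
  its expectation becomes almost sure.

  Part (2). The sum of a window of \<open>x\<close> has mean of order \<open>k powr (1/2 + \<delta>)\<close>, the sum of a uniform word
  has mean 0, and both have standard deviation at most of order \<open>sqrt k\<close>. By Chebyshev's inequality a
  uniform word therefore typically does not occur at all.
\<close>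

section \<open>Dependence on a set of coordinates\<close>

text \<open>Agreement is tested on all functions, not only on points of the product space, so
  coordinate updates \<open>x(a := u)\<close> need no membership conditions. For empty
  \<open>A\<close> the function is constant.\<close>

definition depends_on :: "(('i \<Rightarrow> 'a) \<Rightarrow> 'b) \<Rightarrow> 'i set \<Rightarrow> bool" where
  "depends_on f A \<longleftrightarrow> (\<forall>x y. (\<forall>a\<in>A. x a = y a) \<longrightarrow> f x = f y)"

lemma depends_onI: "(\<And>x y. (\<And>a. a \<in> A \<Longrightarrow> x a = y a) \<Longrightarrow> f x = f y) \<Longrightarrow> depends_on f A"
  unfolding depends_on_def by blast

lemma depends_onD: "depends_on f A \<Longrightarrow> (\<And>a. a \<in> A \<Longrightarrow> x a = y a) \<Longrightarrow> f x = f y"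
  unfolding depends_on_def by blast

lemma depends_on_mono: "depends_on f A \<Longrightarrow> A \<subseteq> B \<Longrightarrow> depends_on f B"
  unfolding depends_on_def by blast

lemma depends_on_comp: "depends_on f A \<Longrightarrow> depends_on (\<lambda>x. h (f x)) A"
  unfolding depends_on_def by metis

lemma depends_on_comp2:
  "depends_on f A \<Longrightarrow> depends_on g A \<Longrightarrow> depends_on (\<lambda>x. h (f x) (g x)) A"
  unfolding depends_on_def by metis

lemma depends_on_const: "depends_on (\<lambda>x. c) A"
  unfolding depends_on_def by metis

lemma depends_on_sum:
  "(\<And>i. i \<in> I \<Longrightarrow> depends_on (f i) A) \<Longrightarrow> depends_on (\<lambda>x. \<Sum>i\<in>I. f i x) A"
  unfolding depends_on_def by (auto intro!: sum.cong)

lemma depends_on_window: "{j..<j + k} \<subseteq> A \<Longrightarrow> depends_on (\<lambda>x. map x [j..<j + k]) A"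
  unfolding depends_on_def by (auto simp: map_eq_conv)

text \<open>The point masses of \<open>sign_measure\<close> as real numbers. Every argument other
  than 1 is treated like -1, so nonnegativity and upper bounds hold without knowing that
  \<open>s\<close> is a sign.\<close>

definition weight :: "real \<Rightarrow> int \<Rightarrow> real" where
  "weight g s = (if s = 1 then 1/2 + g else 1/2 - g)"

lemma space_sign_measure [simp]: "space (sign_measure g) = {-1, 1}"
  and sets_sign_measure [simp]: "sets (sign_measure g) = Pow {-1, 1}"
  by (simp_all add: sign_measure_def space_point_measure sets_point_measure)

section \<open>Sign words\<close>

lemma finite_sign_words [simp]: "finite (sign_words k)"
  unfolding sign_words_def by (rule finite_lists_length_eq) simp

lemma card_sign_words [simp]: "card (sign_words k) = 2 ^ k"
proof -
  have "card (sign_words k) = card {-1, 1 :: int} ^ k"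
    unfolding sign_words_def by (rule card_lists_length_eq) simp
  then show ?thesis by (simp add: numeral_2_eq_2)
qed

lemma sign_words_0 [simp]: "sign_words 0 = {[]}"
  by (auto simp: sign_words_def)

text \<open>Words grow at the right end because \<open>[j..<j + Suc k]\<close> does; inductions on
  the window length then add one coordinate and one letter together.\<close>

lemma sign_words_Suc:
  "sign_words (Suc k) = (\<lambda>(u, s). u @ [s]) ` (sign_words k \<times> {-1, 1})"
proof
  show "sign_words (Suc k) \<subseteq> (\<lambda>(u, s). u @ [s]) ` (sign_words k \<times> {-1, 1})"
  proof
    fix w assume "w \<in> sign_words (Suc k)"
    then show "w \<in> (\<lambda>(u, s). u @ [s]) ` (sign_words k \<times> {-1, 1})"
      by (cases w rule: rev_cases) (auto simp: sign_words_def image_iff)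
  qed
qed (auto simp: sign_words_def)

lemma sign_words_SucE:
  assumes "w \<in> sign_words (Suc k)"
  obtains u s where "w = u @ [s]" "u \<in> sign_words k" "s \<in> {-1, 1}"
  using assms unfolding sign_words_Suc by auto

lemma length_sign_words: "w \<in> sign_words k \<Longrightarrow> length w = k"
  by (simp add: sign_words_def)

lemma sum_sign_words_Suc:
  fixes f :: "int list \<Rightarrow> real"
  shows "(\<Sum>w\<in>sign_words (Suc k). f w) = (\<Sum>u\<in>sign_words k. f (u @ [1]) + f (u @ [-1]))"
proof -
  have "inj_on (\<lambda>(u, s). u @ [s]) (sign_words k \<times> {-1, 1 :: int})"
    by (auto simp: inj_on_def)
  then have "(\<Sum>w\<in>sign_words (Suc k). f w) = (\<Sum>(u, s)\<in>sign_words k \<times> {-1, 1}. f (u @ [s]))"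
    unfolding sign_words_Suc by (subst sum.reindex) (simp_all add: case_prod_beta comp_def)
  also have "\<dots> = (\<Sum>u\<in>sign_words k. \<Sum>s\<in>{-1, 1}. f (u @ [s]))"
    by (rule sum.cartesian_product[symmetric])
  also have "\<dots> = (\<Sum>u\<in>sign_words k. f (u @ [1]) + f (u @ [-1]))"
    by (simp add: add.commute)
  finally show ?thesis .
qed

text \<open>Distributivity: expanding a product of \<open>k\<close> binary sums gives one term per
  word. Sums over all words thus factor coordinate by coordinate.\<close>

lemma sum_prod_sign_words:
  fixes \<phi> :: "nat \<Rightarrow> int \<Rightarrow> real"
  shows "(\<Sum>w\<in>sign_words k. \<Prod>i<k. \<phi> i (w ! i)) = (\<Prod>i<k. \<phi> i 1 + \<phi> i (-1))"
proof (induction k)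
  case (Suc k)
  have "(\<Prod>i<Suc k. \<phi> i ((u @ [s]) ! i)) = (\<Prod>i<k. \<phi> i (u ! i)) * \<phi> k s"
    if "u \<in> sign_words k" for u s
    using length_sign_words[OF that] by (simp add: nth_append)
  then have "(\<Sum>w\<in>sign_words (Suc k). \<Prod>i<Suc k. \<phi> i (w ! i)) =
      (\<Sum>u\<in>sign_words k. (\<Prod>i<k. \<phi> i (u ! i)) * (\<phi> k 1 + \<phi> k (-1)))"
    unfolding sum_sign_words_Suc by (intro sum.cong refl) (simp add: algebra_simps)
  also have "\<dots> = (\<Prod>i<Suc k. \<phi> i 1 + \<phi> i (-1))"
    by (simp add: sum_distrib_right[symmetric] Suc)
  finally show ?case .
qed simp

text \<open>Second moment of the simple random walk: the two extensions of a word with sum S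
  contribute (S + 1)^2 + (S - 1)^2 = 2 S^2 + 2.\<close>

lemma sum_square_sign_words:
  "(\<Sum>w\<in>sign_words k. (real_of_int (sum_list w))\<^sup>2) = 2 ^ k * real k"
proof (induction k)
  case (Suc k)
  have "(\<Sum>w\<in>sign_words (Suc k). (real_of_int (sum_list w))\<^sup>2) =
      (\<Sum>u\<in>sign_words k. 2 * (real_of_int (sum_list u))\<^sup>2 + 2)"
    unfolding sum_sign_words_Suc
    by (intro sum.cong refl) (simp add: power2_eq_square algebra_simps)
  also have "\<dots> = 2 ^ Suc k * real (Suc k)"
    by (simp add: sum.distrib sum_distrib_left[symmetric] Suc algebra_simps)
  finally show ?case .
qed simp

lemma map_upt_Suc: "map x [j..<j + Suc k] = map x [j..<j + k] @ [x (j + k)]"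
  by simp

lemma prob_sign_words:
  "measure_pmf.prob (pmf_of_set (sign_words k)) A = real (card (sign_words k \<inter> A)) / 2 ^ k"
proof -
  have "sign_words k \<noteq> {}" using card_sign_words[of k] by (metis card.empty power_not_zero zero_neq_numeral)
  then show ?thesis by (simp add: measure_pmf_of_set)
qed

text \<open>Chebyshev's inequality for a uniform word, in counting form.\<close>

lemma card_sum_list_gt:
  assumes "0 < t"
  shows "real (card {w \<in> sign_words k. t < real_of_int (sum_list w)}) \<le> 2 ^ k * (real k / t\<^sup>2)"
proof -
  have "t\<^sup>2 * real (card {w \<in> sign_words k. t < real_of_int (sum_list w)}) =
      (\<Sum>w \<in> {w \<in> sign_words k. t < real_of_int (sum_list w)}. t\<^sup>2)"
    by simp
  also have "\<dots> \<le> (\<Sum>w \<in> {w \<in> sign_words k. t < real_of_int (sum_list w)}. (real_of_int (sum_list w))\<^sup>2)"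
    using assms by (intro sum_mono power_mono) auto
  also have "\<dots> \<le> (\<Sum>w \<in> sign_words k. (real_of_int (sum_list w))\<^sup>2)"
    by (intro sum_mono2) auto
  also have "\<dots> = 2 ^ k * real k" by (rule sum_square_sign_words)
  finally show ?thesis using assms by (simp add: field_simps)
qed

section \<open>Stein equation of the Poisson distribution\<close>

text \<open>Stein's equation is solved by tail sums: with \<open>h\<close> the right-hand side,
  splitting the head off the series \<open>T m\<close> gives the recursion, and comparison with the
  exponential series gives a bound uniform in \<open>m\<close> and \<open>n\<close>.\<close>

lemma poisson_stein_solution:
  fixes n :: nat
  obtains g :: "nat \<Rightarrow> real"
  where "\<And>m. \<bar>g m\<bar> \<le> exp 1"
    and "\<And>m. g (Suc m) - real m * g m = of_bool (m = n) - 1 / (exp 1 * fact n)"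
proof -
  define h :: "nat \<Rightarrow> real" where "h m = of_bool (m = n) - 1 / (exp 1 * fact n)" for m
  define T where "T m = (\<Sum>i. h (i + m) / fact (i + m))" for m
  \<comment> \<open>The truncated \<open>m - 1\<close> only matters for \<open>g 0\<close>, which
    the equation multiplies by 0.\<close>
  define g where "g m = - (fact (m - 1) * T m)" for m
  have e: "(\<lambda>i. 1 / fact i :: real) sums exp 1"
    using exp_converges[of "1 :: real"] by (simp add: divide_inverse)
  have h_abs: "\<bar>h m\<bar> \<le> 1" for m
  proof -
    have "1 / (exp 1 * fact n) \<le> (1 :: real)" "0 \<le> 1 / (exp 1 * fact n :: real)"
      using mult_mono[of 1 "exp 1" 1 "fact n :: real"] by (auto simp: fact_ge_1)
    then show ?thesis by (auto simp: h_def)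
  qed
  \<comment> \<open>As (m-1)! i! divides (m-1+i)!, the prefactor (m-1)! is absorbed and the terms
    are dominated by 1/i! independently of \<open>m\<close>.\<close>
  have fact_le: "fact (m - 1) / fact (i + m) \<le> 1 / (fact i :: real)" for i m :: nat
  proof -
    have "fact (m - 1) * fact i \<le> (fact (m - 1 + i) :: nat)"
      by (intro dvd_imp_le fact_fact_dvd_fact) simp
    also have "\<dots> \<le> fact (i + m)" by (intro fact_mono) simp
    finally have "fact (m - 1) * fact i \<le> (fact (i + m) :: real)"
      by (metis of_nat_fact of_nat_le_iff of_nat_mult)
    then show ?thesis by (simp add: field_simps)
  qed
  have h_le: "fact (m - 1) * \<bar>h (i + m) / fact (i + m)\<bar> \<le> 1 / fact i" for i m
  proof -
    have "fact (m - 1) * \<bar>h (i + m) / fact (i + m)\<bar> = \<bar>h (i + m)\<bar> * (fact (m - 1) / fact (i + m))"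
      by (simp add: abs_mult)
    also have "\<dots> \<le> 1 * (1 / fact i)"
      by (intro mult_mono h_abs fact_le) auto
    finally show ?thesis by simp
  qed
  have summ: "summable (\<lambda>i. \<bar>h (i + m) / fact (i + m)\<bar>)" for m
  proof (rule summable_comparison_test')
    show "summable (\<lambda>i. 1 / fact i :: real)" using e by (rule sums_summable)
    fix i :: nat
    have "1 * \<bar>h (i + m) / fact (i + m)\<bar> \<le> fact (m - 1) * \<bar>h (i + m) / fact (i + m)\<bar>"
      by (intro mult_right_mono fact_ge_1) auto
    then show "norm \<bar>h (i + m) / fact (i + m)\<bar> \<le> 1 / fact i"
      using h_le[of m i] by simp
  qed
  have "\<bar>g m\<bar> \<le> exp 1" for m
  proof -
    have "\<bar>g m\<bar> = fact (m - 1) * \<bar>T m\<bar>" by (simp add: g_def abs_mult)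
    also have "\<dots> \<le> fact (m - 1) * (\<Sum>i. \<bar>h (i + m) / fact (i + m)\<bar>)"
      unfolding T_def by (intro mult_left_mono summable_rabs summ) auto
    also have "\<dots> = (\<Sum>i. fact (m - 1) * \<bar>h (i + m) / fact (i + m)\<bar>)"
      by (rule suminf_mult[OF summ, symmetric])
    also have "\<dots> \<le> (\<Sum>i. 1 / fact i)"
      by (intro suminf_le h_le summable_mult summ sums_summable[OF e])
    also have "\<dots> = exp 1" using e by (rule sums_unique[symmetric])
    finally show ?thesis .
  qed
  moreover have "g (Suc m) - real m * g m = h m" for m
  proof -
    have "T m = h m / fact m + T (Suc m)"
      using suminf_split_head[OF summable_rabs_cancel[OF summ[of m]]] by (simp add: T_def)
    \<comment> \<open>This is the mean of \<open>h\<close> under Poisson(1), up to the factor e. Its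
      vanishing is what makes the equation hold at \<open>m = 0\<close>.\<close>
    moreover have "T 0 = 0"
    proof -
      have "(\<lambda>i. of_bool (i = n) / fact i :: real) sums (1 / fact n)"
        using sums_If_finite[of "\<lambda>i. i = n" "\<lambda>i. 1 / fact i :: real"]
        by (simp add: of_bool_def if_distrib[of "\<lambda>c. c / _"] cong: if_cong)
      from sums_diff[OF this sums_mult[OF e, of "1 / (exp 1 * fact n)"]]
      have "(\<lambda>i. h i / fact i) sums 0" by (simp add: h_def field_simps)
      then show ?thesis by (simp add: T_def sums_iff)
    qed
    moreover have "fact m = real m * fact (m - 1)" if "m \<noteq> 0"
      using that by (simp add: fact_reduce)
    ultimately show ?thesis
      by (cases "m = 0") (auto simp: g_def field_simps)
  qed
  ultimately show thesis using that unfolding h_def by blast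
qed

section \<open>An almost sure convergence criterion and counts over sets of windows\<close>

text \<open>By monotone convergence the sum of all \<open>f k\<close> has finite integral, so it is
  finite almost everywhere and its terms tend to 0. This plays the role of Borel--Cantelli.\<close>

lemma AE_tendsto_zero_of_summable_integral:
  fixes f :: "nat \<Rightarrow> 'a \<Rightarrow> real"
  assumes int: "\<And>k. integrable M (f k)" and nonneg: "\<And>k x. 0 \<le> f k x"
    and summ: "summable (\<lambda>k. \<integral>x. f k x \<partial>M)"
  shows "AE x in M. (\<lambda>k. f k x) \<longlonglongrightarrow> 0"
proof -
  have [measurable]: "f k \<in> borel_measurable M" for k using int by blast
  have "(\<integral>\<^sup>+x. (\<Sum>k. ennreal (f k x)) \<partial>M) = (\<Sum>k. \<integral>\<^sup>+x. ennreal (f k x) \<partial>M)"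
    by (intro nn_integral_suminf) simp
  also have "\<dots> = (\<Sum>k. ennreal (\<integral>x. f k x \<partial>M))"
    using int nonneg by (simp add: nn_integral_eq_integral)
  also have "\<dots> = ennreal (\<Sum>k. \<integral>x. f k x \<partial>M)"
    by (intro suminf_ennreal2 summ integral_nonneg_AE) (simp add: nonneg)
  finally have "(\<integral>\<^sup>+x. (\<Sum>k. ennreal (f k x)) \<partial>M) \<noteq> \<infinity>" by simp
  from nn_integral_PInf_AE[OF _ this] show ?thesis
    by (auto elim!: eventually_mono intro: summable_LIMSEQ_zero summable_suminf_not_top nonneg)
qed

text \<open>An arbitrary set of starting positions is allowed so that early windows, and windows
  overlapping a given one, can be left out.\<close>

definition window_count :: "nat set \<Rightarrow> nat \<Rightarrow> (nat \<Rightarrow> int) \<Rightarrow> int list \<Rightarrow> nat" where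
  "window_count J k x w = card {j \<in> J. map x [j..<j + k] = w}"

lemma occurrences_eq_window_count: "occurrences x k w = window_count {1..2 ^ k} k x w"
  by (simp add: occurrences_def window_count_def)

lemma depends_on_window_count:
  assumes "\<And>j. j \<in> J \<Longrightarrow> {j..<j + k} \<subseteq> A"
  shows "depends_on (\<lambda>x. window_count J k x w) A"
proof (rule depends_onI)
  fix x y :: "nat \<Rightarrow> int" assume "\<And>a. a \<in> A \<Longrightarrow> x a = y a"
  then have "map x [j..<j + k] = map y [j..<j + k]" if "j \<in> J" for j
    using assms[OF that] by (auto simp: map_eq_conv)
  then show "window_count J k x w = window_count J k y w"
    unfolding window_count_def by (metis (mono_tags, lifting))
qed

lemma window_count_eq_sum:
  "finite J \<Longrightarrow> real (window_count J k x w) = (\<Sum>j\<in>J. of_bool (map x [j..<j + k] = w))"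
  by (simp add: window_count_def of_bool_def sum.If_cases Int_def)

lemma window_count_Un:
  "finite J \<Longrightarrow> finite J' \<Longrightarrow> J \<inter> J' = {} \<Longrightarrow>
    window_count (J \<union> J') k x w = window_count J k x w + window_count J' k x w"
  unfolding window_count_def by (subst card_Un_disjoint[symmetric]) (auto intro: arg_cong[where f = card])

section \<open>Expectations of functions of finitely many coordinates\<close>

locale sign_bias =
  fixes \<gamma> :: "nat \<Rightarrow> real"
  assumes bias: "\<bar>\<gamma> n\<bar> < 1/2"
begin

lemma weight_nonneg [simp]: "0 \<le> weight (\<gamma> n) s"
  using bias[of n] by (auto simp: weight_def)

lemma weight_sum [simp]: "weight (\<gamma> n) 1 + weight (\<gamma> n) (-1) = 1"
  by (simp add: weight_def)

lemma emeasure_sign_measure_singleton: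
  "s \<in> {-1, 1} \<Longrightarrow> emeasure (sign_measure (\<gamma> n)) {s} = ennreal (weight (\<gamma> n) s)"
  unfolding sign_measure_def
  by (subst emeasure_point_measure_finite) (auto simp: weight_def)

lemma prob_space_sign_measure: "prob_space (sign_measure (\<gamma> n))"
proof
  have "emeasure (sign_measure (\<gamma> n)) {-1, 1} = ennreal (1/2 - \<gamma> n) + ennreal (1/2 + \<gamma> n)"
    unfolding sign_measure_def by (subst emeasure_point_measure_finite) auto
  also have "\<dots> = 1"
    using bias[of n] by (subst ennreal_plus[symmetric]) auto
  finally show "emeasure (sign_measure (\<gamma> n)) (space (sign_measure (\<gamma> n))) = 1"
    by simp
qed

sublocale X: product_prob_space "\<lambda>n. sign_measure (\<gamma> n)" "{1..}"
  using prob_space_sign_measure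
  by (simp add: product_prob_space_def product_prob_space_axioms_def product_sigma_finite_def
        prob_space_imp_sigma_finite)

abbreviation "\<nu> \<equiv> sign_product \<gamma>"

sublocale prob_space \<nu>
  unfolding sign_product_def by (rule X.prob_space_axioms)

lemma space_sign_product: "space \<nu> = {1..} \<rightarrow>\<^sub>E {-1, 1}"
  by (simp add: sign_product_def space_PiM)

lemma space_sign_productD: "x \<in> space \<nu> \<Longrightarrow> 1 \<le> a \<Longrightarrow> x a = -1 \<or> x a = 1"
  by (auto simp: space_sign_product PiE_iff)

lemma sets_cylinder:
  assumes "finite A" "A \<subseteq> {1..}"
  shows "{x \<in> space \<nu>. \<forall>a\<in>A. x a = y a} \<in> sets \<nu>"
proof -
  have "{x \<in> space \<nu>. x a = y a} \<in> sets \<nu>" if "a \<in> A" for a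
  proof -
    have "(\<lambda>x. x a) \<in> measurable \<nu> (sign_measure (\<gamma> a))"
      unfolding sign_product_def by (rule measurable_component_singleton) (use that assms in auto)
    from measurable_sets[OF this, of "{y a} \<inter> {-1, 1}"]
    have "(\<lambda>x. x a) -` ({y a} \<inter> {-1, 1}) \<inter> space \<nu> \<in> sets \<nu>" by auto
    also have "(\<lambda>x. x a) -` ({y a} \<inter> {-1, 1}) \<inter> space \<nu> = {x \<in> space \<nu>. x a = y a}"
      using space_sign_productD[of _ a] that assms(2) by fastforce
    finally show ?thesis .
  qed
  then show ?thesis
    using assms(1) by (intro sets.sets_Collect_finite_All)
qed

lemma prob_cylinder:
  assumes "finite A" "A \<subseteq> {1..}" "\<And>a. a \<in> A \<Longrightarrow> y a \<in> {-1, 1}"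
  shows "prob {x \<in> space \<nu>. \<forall>a\<in>A. x a = y a} = (\<Prod>a\<in>A. weight (\<gamma> a) (y a))"
proof -
  have "emeasure \<nu> {x \<in> space \<nu>. \<forall>a\<in>A. x a \<in> {y a}}
      = (\<Prod>a\<in>A. emeasure (sign_measure (\<gamma> a)) {y a})"
    unfolding sign_product_def
    by (rule X.emeasure_PiM_Collect) (use assms in auto)
  also have "\<dots> = (\<Prod>a\<in>A. ennreal (weight (\<gamma> a) (y a)))"
    by (intro prod.cong refl emeasure_sign_measure_singleton assms)
  also have "\<dots> = ennreal (\<Prod>a\<in>A. weight (\<gamma> a) (y a))"
    by (rule prod_ennreal) simp
  finally show ?thesis
    by (simp add: measure_def prod_nonneg)
qed

text \<open>A point lies in exactly one cylinder over \<open>A\<close>, that of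
  \<open>restrict x A\<close>. Hence a function of finitely many coordinates is a finite combination
  of cylinder indicators, which reduces integrability and expectations to finite sums.\<close>

lemma cylinder_expansion:
  fixes f :: "(nat \<Rightarrow> int) \<Rightarrow> real"
  assumes "finite A" "A \<subseteq> {1..}" "depends_on f A" "x \<in> space \<nu>"
  shows "f x = (\<Sum>y\<in>A \<rightarrow>\<^sub>E {-1, 1}. f y * indicator {x \<in> space \<nu>. \<forall>a\<in>A. x a = y a} x)"
proof -
  have r: "restrict x A \<in> A \<rightarrow>\<^sub>E {-1, 1}"
    using space_sign_productD[OF assms(4)] assms(2) by fastforce
  have "(\<Sum>y\<in>A \<rightarrow>\<^sub>E {-1, 1}. f y * indicator {x \<in> space \<nu>. \<forall>a\<in>A. x a = y a} x)
      = (\<Sum>y\<in>{restrict x A}. f y * indicator {x \<in> space \<nu>. \<forall>a\<in>A. x a = y a} x)"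
  proof (rule sum.mono_neutral_right)
    show "\<forall>i\<in>(A \<rightarrow>\<^sub>E {- 1, 1}) - {restrict x A}.
       f i * indicator {x \<in> space \<nu>. \<forall>a\<in>A. x a = i a} x = 0"
    proof
      fix y assume y: "y \<in> (A \<rightarrow>\<^sub>E {- 1, 1 :: int}) - {restrict x A}"
      then have "\<not> (\<forall>a\<in>A. x a = y a)"
        by (metis Diff_iff PiE_restrict restrict_ext singletonI)
      then show "f y * indicator {x \<in> space \<nu>. \<forall>a\<in>A. x a = y a} x = 0" by simp
    qed
  qed (use assms r in \<open>auto intro: finite_PiE\<close>)
  also have "\<dots> = f (restrict x A)" using assms by simp
  also have "\<dots> = f x" by (rule depends_onD[OF assms(3)]) simp
  finally show ?thesis ..
qed

lemma integrable_depends_on: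
  fixes f :: "(nat \<Rightarrow> int) \<Rightarrow> real"
  assumes "finite A" "A \<subseteq> {1..}" "depends_on f A"
  shows "integrable \<nu> f"
proof -
  have "integrable \<nu> (\<lambda>x. \<Sum>y\<in>A \<rightarrow>\<^sub>E {-1, 1}. f y * indicator {x \<in> space \<nu>. \<forall>a\<in>A. x a = y a} x)"
    using sets_cylinder[OF assms(1,2)]
    by (intro Bochner_Integration.integrable_sum integrable_mult_right)
       (auto simp: emeasure_eq_measure)
  then show ?thesis
    by (subst Bochner_Integration.integrable_cong[OF refl cylinder_expansion[OF assms]])
qed

lemma expectation_depends_on:
  fixes f :: "(nat \<Rightarrow> int) \<Rightarrow> real"
  assumes "finite A" "A \<subseteq> {1..}" "depends_on f A"
  shows "expectation f = (\<Sum>y\<in>A \<rightarrow>\<^sub>E {-1, 1}. f y * (\<Prod>a\<in>A. weight (\<gamma> a) (y a)))"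
proof -
  have "expectation f = expectation
     (\<lambda>x. \<Sum>y\<in>A \<rightarrow>\<^sub>E {-1, 1}. f y * indicator {x \<in> space \<nu>. \<forall>a\<in>A. x a = y a} x)"
    by (rule Bochner_Integration.integral_cong[OF refl cylinder_expansion[OF assms]])
  also have "\<dots> = (\<Sum>y\<in>A \<rightarrow>\<^sub>E {-1, 1}. f y * prob {x \<in> space \<nu>. \<forall>a\<in>A. x a = y a})"
    using sets_cylinder[OF assms(1,2)]
    by (subst Bochner_Integration.integral_sum)
       (auto simp: emeasure_eq_measure intro!: integrable_mult_right sum.cong)
  also have "\<dots> = (\<Sum>y\<in>A \<rightarrow>\<^sub>E {-1, 1}. f y * (\<Prod>a\<in>A. weight (\<gamma> a) (y a)))"
    by (intro sum.cong refl arg_cong2[where f = "(*)"] prob_cylinder assms) auto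
  finally show ?thesis .
qed

text \<open>Independence of a fresh coordinate: sign patterns on \<open>insert a A\<close>
  correspond to pairs of a sign and a pattern on \<open>A\<close>, and the finite sum factors
  accordingly.\<close>

lemma expectation_mult_coordinate:
  fixes f :: "(nat \<Rightarrow> int) \<Rightarrow> real"
  assumes A: "finite A" "A \<subseteq> {1..}" "depends_on f A" and a: "a \<notin> A" "1 \<le> a" "s \<in> {-1, 1}"
  shows "expectation (\<lambda>x. f x * of_bool (x a = s)) = weight (\<gamma> a) s * expectation f"
proof -
  have dep: "depends_on (\<lambda>x. f x * of_bool (x a = s)) (insert a A)"
    using A(3) by (auto simp: depends_on_def)
  have inj: "inj_on (\<lambda>(u, y). y(a := u)) ({-1, 1} \<times> (A \<rightarrow>\<^sub>E {-1, 1 :: int}))"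
    using a(1) by (rule inj_combinator)
  have "expectation (\<lambda>x. f x * of_bool (x a = s)) =
     (\<Sum>y\<in>insert a A \<rightarrow>\<^sub>E {-1, 1}. f y * of_bool (y a = s) * (\<Prod>a\<in>insert a A. weight (\<gamma> a) (y a)))"
    using A a by (intro expectation_depends_on[OF _ _ dep]) auto
  also have "insert a A \<rightarrow>\<^sub>E {-1, 1 :: int} = (\<lambda>(u, y). y(a := u)) ` ({-1, 1} \<times> (A \<rightarrow>\<^sub>E {-1, 1}))"
    by (rule PiE_insert_eq)
  also have "(\<Sum>y\<in>\<dots>. f y * of_bool (y a = s) * (\<Prod>a\<in>insert a A. weight (\<gamma> a) (y a)))
      = (\<Sum>(u, y)\<in>{-1, 1} \<times> (A \<rightarrow>\<^sub>E {-1, 1}). f (y(a := u)) * of_bool (u = s) *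
           (\<Prod>b\<in>insert a A. weight (\<gamma> b) ((y(a := u)) b)))"
    by (subst sum.reindex[OF inj]) (simp add: case_prod_beta)
  also have "\<dots> = (\<Sum>(u, y)\<in>{-1, 1} \<times> (A \<rightarrow>\<^sub>E {-1, 1}). of_bool (u = s) * weight (\<gamma> a) s *
           (f y * (\<Prod>b\<in>A. weight (\<gamma> b) (y b))))"
  proof (intro sum.cong refl, clarify)
    fix u :: int and y :: "nat \<Rightarrow> int"
    have 1: "f (y(a := u)) = f y" using a by (intro depends_onD[OF A(3)]) auto
    have 2: "(\<Prod>b\<in>A. weight (\<gamma> b) ((y(a := u)) b)) = (\<Prod>b\<in>A. weight (\<gamma> b) (y b))"
      using a by (intro prod.cong) auto
    show "f (y(a := u)) * of_bool (u = s) * (\<Prod>b\<in>insert a A. weight (\<gamma> b) ((y(a := u)) b)) =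
       of_bool (u = s) * weight (\<gamma> a) s * (f y * (\<Prod>b\<in>A. weight (\<gamma> b) (y b)))"
      unfolding 1 prod.insert[OF A(1) a(1)] 2 by auto
  qed
  also have "\<dots> = (\<Sum>u\<in>{-1, 1}. of_bool (u = s) * weight (\<gamma> a) s) *
        (\<Sum>y\<in>A \<rightarrow>\<^sub>E {-1, 1}. f y * (\<Prod>b\<in>A. weight (\<gamma> b) (y b)))"
    by (simp add: sum.cartesian_product[symmetric] sum_product)
  also have "(\<Sum>u\<in>{-1, 1}. of_bool (u = s) * weight (\<gamma> a) s) = weight (\<gamma> a) s"
    using a by auto
  also have "(\<Sum>y\<in>A \<rightarrow>\<^sub>E {-1, 1}. f y * (\<Prod>b\<in>A. weight (\<gamma> b) (y b))) = expectation f"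
    by (rule expectation_depends_on[OF A, symmetric])
  finally show ?thesis .
qed

section \<open>Conditional averaging and the Efron--Stein inequality\<close>

text \<open>The conditional expectation of \<open>f\<close> given all coordinates except
  \<open>a\<close>, as an explicit two-point average defined at every \<open>x\<close>.\<close>

definition average :: "nat \<Rightarrow> ((nat \<Rightarrow> int) \<Rightarrow> real) \<Rightarrow> (nat \<Rightarrow> int) \<Rightarrow> real" where
  "average a f x = weight (\<gamma> a) 1 * f (x(a := 1)) + weight (\<gamma> a) (-1) * f (x(a := -1))"

lemma depends_on_update:
  "depends_on f A \<Longrightarrow> depends_on (\<lambda>x. f (x(a := u))) (A - {a})"
  unfolding depends_on_def by (metis Diff_iff fun_upd_apply singletonD)

lemma depends_on_average:
  assumes "depends_on f A"
  shows "depends_on (average a f) (A - {a})"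
  unfolding average_def using depends_on_update[OF assms]
  by (intro depends_on_comp2[where h = "\<lambda>p q. weight (\<gamma> a) 1 * p + weight (\<gamma> a) (-1) * q"])

text \<open>Tower property: split \<open>f\<close> according to the value of \<open>x a\<close>; on
  each part the updated function no longer involves coordinate \<open>a\<close>, so that coordinate
  factors out.\<close>

lemma expectation_average:
  assumes A: "finite A" "A \<subseteq> {1..}" "depends_on f A" and a: "1 \<le> a"
  shows "expectation (average a f) = expectation f"
proof -
  let ?f = "\<lambda>u x. f (x(a := u))"
  have fin: "finite (A - {a})" "A - {a} \<subseteq> {1..}" using A by auto
  have d: "depends_on (?f u) (A - {a})" for u by (rule depends_on_update[OF A(3)])
  have i: "integrable \<nu> (\<lambda>x. ?f u x * of_bool (x a = u))" for u
    using A a d[of u]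
    by (intro integrable_depends_on[of "insert a A"]) (auto simp: depends_on_def)
  have "expectation f =
      expectation (\<lambda>x. ?f 1 x * of_bool (x a = 1) + ?f (-1) x * of_bool (x a = -1))"
  proof (rule Bochner_Integration.integral_cong[OF refl])
    fix x assume "x \<in> space \<nu>"
    from space_sign_productD[OF this a] have "x a = -1 \<or> x a = 1" .
    then show "f x = ?f 1 x * of_bool (x a = 1) + ?f (-1) x * of_bool (x a = -1)"
      by (auto simp: fun_upd_idem)
  qed
  also have "\<dots> = weight (\<gamma> a) 1 * expectation (?f 1) + weight (\<gamma> a) (-1) * expectation (?f (-1))"
    using i by (subst Bochner_Integration.integral_add)
      (simp_all add: expectation_mult_coordinate[OF fin d _ a])
  also have "\<dots> = expectation (average a f)"
    unfolding average_def
    using integrable_depends_on[OF fin d]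
    by (subst Bochner_Integration.integral_add) auto
  finally show ?thesis ..
qed

text \<open>
  Efron--Stein by induction on the coordinates: the increment between a function and its average
  over one coordinate is orthogonal to every function not depending on that coordinate.
\<close>

lemma variance_bounded_differences:
  fixes f :: "(nat \<Rightarrow> int) \<Rightarrow> real"
  assumes "finite A" "A \<subseteq> {1..}" "depends_on f A"
    and "\<And>a x u v. a \<in> A \<Longrightarrow> u \<in> {-1, 1} \<Longrightarrow> v \<in> {-1, 1} \<Longrightarrow> \<bar>f (x(a := u)) - f (x(a := v))\<bar> \<le> c"
  shows "variance f \<le> real (card A) * c\<^sup>2"
  using assms
proof (induction A arbitrary: f rule: finite_induct)
  case empty
  have "f = (\<lambda>x. f undefined)" using empty(2) by (auto simp: depends_on_def)
  then have "variance f = variance (\<lambda>x. f undefined)" by metis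
  then show ?case by (simp add: prob_space)
next
  case (insert a A)
  let ?g = "average a f"
  have a: "1 \<le> a" using insert by auto
  have fin: "finite (insert a A)" "insert a A \<subseteq> {1..}" using insert by auto
  have dg: "depends_on ?g A"
    using depends_on_average[OF insert.prems(2), of a] insert.hyps by simp
  have dg': "depends_on ?g (insert a A)" by (rule depends_on_mono[OF dg]) auto
  have Eg: "expectation ?g = expectation f"
    by (rule expectation_average[OF fin insert.prems(2) a])
  have upd: "?g (x(a := u)) = ?g x" for x u by (simp add: average_def)
  let ?h1 = "\<lambda>x. (f x - ?g x)\<^sup>2"
  let ?h2 = "\<lambda>x. (f x - ?g x) * (?g x - expectation f)"
  let ?h3 = "\<lambda>x. (?g x - expectation f)\<^sup>2"
  have d1: "depends_on ?h1 (insert a A)"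
    by (rule depends_on_comp2[OF insert.prems(2) dg', of "\<lambda>p q. (p - q)\<^sup>2"])
  have d2: "depends_on ?h2 (insert a A)"
    by (rule depends_on_comp2[OF insert.prems(2) dg', of "\<lambda>p q. (p - q) * (q - expectation f)"])
  have d3: "depends_on ?h3 (insert a A)"
    by (rule depends_on_comp[OF dg', of "\<lambda>q. (q - expectation f)\<^sup>2"])
  note int = integrable_depends_on[OF fin d1] integrable_depends_on[OF fin d2]
    integrable_depends_on[OF fin d3]
  have "variance f = expectation (\<lambda>x. ?h1 x + 2 * ?h2 x + ?h3 x)"
    by (intro Bochner_Integration.integral_cong refl) (simp add: power2_eq_square algebra_simps)
  also have "\<dots> = expectation ?h1 + 2 * expectation ?h2 + expectation ?h3"
    using int by simp
  \<comment> \<open>The cross term: averaging over \<open>a\<close> annihilates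
    \<open>f - ?g\<close> and leaves the factor \<open>?g - expectation f\<close> unchanged.\<close>
  also have "expectation ?h2 = expectation (average a ?h2)"
    by (rule expectation_average[OF fin d2 a, symmetric])
  also have "average a ?h2 = (\<lambda>x. 0)"
  proof
    fix x
    have w: "weight (\<gamma> a) (-1) = 1 - weight (\<gamma> a) 1"
      using weight_sum[of a] by linarith
    show "average a ?h2 x = 0"
      unfolding average_def[of a ?h2] upd unfolding average_def w by (simp add: algebra_simps)
  qed
  also have "expectation ?h1 \<le> expectation (\<lambda>x. c\<^sup>2)"
  proof (rule integral_mono[OF int(1)])
    fix x assume x: "x \<in> space \<nu>"
    have xa: "x a \<in> {-1, 1}" using space_sign_productD[OF x a] by auto
    have w: "weight (\<gamma> a) (-1) = 1 - weight (\<gamma> a) 1"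
      using weight_sum[of a] by linarith
    have b: "\<bar>f x - f (x(a := u))\<bar> \<le> c" if "u \<in> {-1, 1}" for u
      using insert.prems(3)[of a "x a" u x] xa that by (simp only: fun_upd_triv insertI1)
    \<comment> \<open>A convex combination of two increments of \<open>f\<close> in coordinate
      \<open>a\<close>, hence at most \<open>c\<close> in absolute value.\<close>
    have "f x - ?g x = weight (\<gamma> a) 1 * (f x - f (x(a := 1))) + weight (\<gamma> a) (-1) * (f x - f (x(a := -1)))"
      unfolding average_def w by (simp add: algebra_simps)
    also have "\<bar>\<dots>\<bar> \<le> weight (\<gamma> a) 1 * c + weight (\<gamma> a) (-1) * c"
      by (intro order_trans[OF abs_triangle_ineq] add_mono)
         (auto simp: abs_mult intro!: mult_left_mono b)
    also have "\<dots> = c" by (simp add: distrib_right[symmetric])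
    finally show "?h1 x \<le> c\<^sup>2" by (rule power2_le_iff_abs_le[THEN iffD2, rotated])
        (use b[of 1] in auto)
  qed simp
  also have "expectation ?h3 = variance ?g" by (simp add: Eg)
  \<comment> \<open>Increments of \<open>?g\<close> in the other coordinates are convex combinations
    of increments of \<open>f\<close>, so the induction hypothesis applies with the same
    \<open>c\<close>.\<close>
  also have "variance ?g \<le> real (card A) * c\<^sup>2"
  proof (rule insert.IH)
    show "A \<subseteq> {1..}" using insert by auto
    fix b x u v assume b: "b \<in> A" and uv: "u \<in> {-1, 1 :: int}" "v \<in> {-1, 1 :: int}"
    have ne: "a \<noteq> b" using b insert by auto
    have "?g (x(b := u)) - ?g (x(b := v)) =
        weight (\<gamma> a) 1 * (f (x(a := 1, b := u)) - f (x(a := 1, b := v)))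
      + weight (\<gamma> a) (-1) * (f (x(a := -1, b := u)) - f (x(a := -1, b := v)))"
      unfolding average_def fun_upd_twist[OF ne] by (simp add: algebra_simps)
    also have "\<bar>\<dots>\<bar> \<le> weight (\<gamma> a) 1 * c + weight (\<gamma> a) (-1) * c"
      using b uv
      by (intro order_trans[OF abs_triangle_ineq] add_mono)
         (auto simp: abs_mult intro!: mult_left_mono insert.prems(3))
    also have "\<dots> = c" by (simp add: distrib_right[symmetric])
    finally show "\<bar>?g (x(b := u)) - ?g (x(b := v))\<bar> \<le> c" .
  qed (rule dg)
  finally show ?case using insert.hyps by (simp add: prob_space algebra_simps)
qed

section \<open>Probabilities of window events\<close>

text \<open>Independence of a window from disjoint coordinates, by peeling off its last letter as a
  fresh coordinate.\<close>

lemma expectation_mult_window: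
  fixes f :: "(nat \<Rightarrow> int) \<Rightarrow> real"
  assumes A: "finite A" "A \<subseteq> {1..}" "depends_on f A" and j: "1 \<le> j"
    and disj: "A \<inter> {j..<j + k} = {}" and w: "w \<in> sign_words k"
  shows "expectation (\<lambda>x. f x * of_bool (map x [j..<j + k] = w)) =
    expectation f * (\<Prod>i<k. weight (\<gamma> (j + i)) (w ! i))"
  using disj w
proof (induction k arbitrary: w)
  case (Suc k)
  from Suc.prems(2) obtain u s where w: "w = u @ [s]" "u \<in> sign_words k" "s \<in> {-1, 1}"
    by (rule sign_words_SucE)
  let ?B = "A \<union> {j..<j + k}"
  have "depends_on (\<lambda>x. f x * of_bool (map x [j..<j + k] = u)) ?B"
    by (intro depends_on_comp2[where h = "\<lambda>p q. p * of_bool (q = u)"]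
          depends_on_mono[OF A(3)] depends_on_window) auto
  then have "expectation (\<lambda>x. f x * of_bool (map x [j..<j + k] = u) * of_bool (x (j + k) = s)) =
      weight (\<gamma> (j + k)) s * expectation (\<lambda>x. f x * of_bool (map x [j..<j + k] = u))"
    using A j Suc.prems(1) w(3) by (intro expectation_mult_coordinate[of ?B]) auto
  moreover have "(\<lambda>x. f x * of_bool (map x [j..<j + Suc k] = w)) =
     (\<lambda>x. f x * of_bool (map x [j..<j + k] = u) * of_bool (x (j + k) = s))"
    unfolding map_upt_Suc w(1) by (auto simp: fun_eq_iff)
  moreover have "A \<inter> {j..<j + k} = {}" using Suc.prems(1) by auto
  moreover have "(\<Prod>i<Suc k. weight (\<gamma> (j + i)) (w ! i)) =
     (\<Prod>i<k. weight (\<gamma> (j + i)) (u ! i)) * weight (\<gamma> (j + k)) s"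
    using length_sign_words[OF w(2)] by (simp add: w(1) nth_append)
  ultimately show ?case using Suc.IH[OF _ w(2)] by simp
qed simp

text \<open>The windows may overlap. Reading from left to right, each of the \<open>k\<close>
  equations fixes the fresh coordinate \<open>j + d + i\<close> in terms of an earlier one, and
  costs a factor at most \<open>1/2 + \<epsilon>\<close>.\<close>

lemma expectation_repeated_window:
  assumes j: "1 \<le> j" "1 \<le> d" and \<epsilon>: "0 \<le> \<epsilon>" "\<And>n. j \<le> n \<Longrightarrow> \<bar>\<gamma> n\<bar> \<le> \<epsilon>"
  shows "expectation (\<lambda>x. of_bool (map x [j..<j + k] = map x [j + d..<j + d + k])) \<le> (1/2 + \<epsilon>) ^ k"
proof (induction k)
  case (Suc k)
  let ?E = "\<lambda>x :: nat \<Rightarrow> int. map x [j..<j + k] = map x [j + d..<j + d + k]"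
  let ?f = "\<lambda>s x. of_bool (?E x \<and> x (j + k) = s) :: real"
  \<comment> \<open>The block contains \<open>j + k\<close> because \<open>1 \<le> d\<close>, and
    stops just before the fresh coordinate \<open>j + d + k\<close>.\<close>
  let ?B = "{j..<j + d + k}"
  have B: "finite ?B" "?B \<subseteq> {1..}" using j by auto
  have d: "depends_on (?f s) ?B" for s
  proof (rule depends_onI)
    fix x y :: "nat \<Rightarrow> int" assume xy: "\<And>a. a \<in> ?B \<Longrightarrow> x a = y a"
    have "map x [j..<j + k] = map y [j..<j + k]" "map x [j + d..<j + d + k] = map y [j + d..<j + d + k]"
      using xy by (auto simp: map_eq_conv)
    moreover have "x (j + k) = y (j + k)" using j by (intro xy) auto
    ultimately show "?f s x = ?f s y" by (simp only:)
  qed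
  have i: "integrable \<nu> (\<lambda>x. ?f s x * of_bool (x (j + d + k) = s))" for s
    using j
    by (intro integrable_depends_on[of "{j..j + d + k}"]
          depends_on_comp2[where h = "\<lambda>p q. p * of_bool (q = s)"] depends_on_mono[OF d])
       (auto simp: depends_on_def)
  have w: "weight (\<gamma> (j + d + k)) s \<le> 1/2 + \<epsilon>" for s
    using \<epsilon>(2)[of "j + d + k"] by (auto simp: weight_def)
  have "expectation (\<lambda>x. of_bool (map x [j..<j + Suc k] = map x [j + d..<j + d + Suc k])) =
     expectation (\<lambda>x. ?f 1 x * of_bool (x (j + d + k) = 1) + ?f (-1) x * of_bool (x (j + d + k) = -1))"
  proof (rule Bochner_Integration.integral_cong[OF refl])
    fix x assume "x \<in> space \<nu>"
    from space_sign_productD[OF this, of "j + k"] j have "x (j + k) = -1 \<or> x (j + k) = 1" by simp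
    then show "of_bool (map x [j..<j + Suc k] = map x [j + d..<j + d + Suc k]) =
      ?f 1 x * of_bool (x (j + d + k) = 1) + ?f (-1) x * of_bool (x (j + d + k) = -1)"
      unfolding map_upt_Suc by auto
  qed
  also have "\<dots> = weight (\<gamma> (j + d + k)) 1 * expectation (?f 1)
      + weight (\<gamma> (j + d + k)) (-1) * expectation (?f (-1))"
    using i j by (subst Bochner_Integration.integral_add)
      (simp_all add: expectation_mult_coordinate[OF B d])
  also have "\<dots> \<le> (1/2 + \<epsilon>) * expectation (?f 1) + (1/2 + \<epsilon>) * expectation (?f (-1))"
    by (intro add_mono mult_right_mono w) (auto intro!: integral_nonneg_AE)
  also have "\<dots> = (1/2 + \<epsilon>) * expectation (\<lambda>x. ?f 1 x + ?f (-1) x)"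
    using integrable_depends_on[OF B d]
    by (subst Bochner_Integration.integral_add) (auto simp: algebra_simps)
  also have "expectation (\<lambda>x. ?f 1 x + ?f (-1) x) = expectation (\<lambda>x. of_bool (?E x))"
  proof (rule Bochner_Integration.integral_cong[OF refl])
    fix x assume "x \<in> space \<nu>"
    from space_sign_productD[OF this, of "j + k"] j have "x (j + k) = -1 \<or> x (j + k) = 1" by simp
    then show "?f 1 x + ?f (-1) x = of_bool (?E x)" by auto
  qed
  also have "(1/2 + \<epsilon>) * expectation (\<lambda>x. of_bool (?E x)) \<le> (1/2 + \<epsilon>) * (1/2 + \<epsilon>) ^ k"
    using \<epsilon>(1) by (intro mult_left_mono Suc) auto
  finally show ?case by simp
qed (simp add: prob_space)

lemma expectation_coordinate:
  assumes "1 \<le> a"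
  shows "expectation (\<lambda>x. real_of_int (x a)) = 2 * \<gamma> a"
proof -
  have "expectation (\<lambda>x. real_of_int (x a)) = expectation (average a (\<lambda>x. real_of_int (x a)))"
    using assms by (intro expectation_average[of "{a}", symmetric]) (auto simp: depends_on_def)
  also have "average a (\<lambda>x. real_of_int (x a)) = (\<lambda>x. 2 * \<gamma> a)"
    by (auto simp: average_def weight_def)
  finally show ?thesis by (simp add: prob_space)
qed

text \<open>Each coordinate has mean twice its bias, so the window sum has mean at least
  \<open>2 * t\<close>; a value at most \<open>t\<close> is a deviation of at least
  \<open>t\<close>. Changing one sign moves the sum by at most 2, so the variance is at most
  \<open>4 * k\<close>.\<close>

lemma chebyshev_window_sum:
  assumes j: "1 \<le> j" and "0 < k" and t: "0 < t" "\<And>n. j \<le> n \<Longrightarrow> n < j + k \<Longrightarrow> t \<le> real k * \<gamma> n"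
  shows "expectation (\<lambda>x. of_bool (real_of_int (sum_list (map x [j..<j + k])) \<le> t)) \<le> 4 * real k / t\<^sup>2"
proof -
  let ?S = "\<lambda>x :: nat \<Rightarrow> int. \<Sum>a\<in>{j..<j + k}. real_of_int (x a)"
  have S: "real_of_int (sum_list (map x [j..<j + k])) = ?S x" for x
    by (simp add: sum_list_distinct_conv_sum_set)
  have d: "depends_on ?S {j..<j + k}" by (auto simp: depends_on_def)
  have fin: "finite {j..<j + k}" "{j..<j + k} \<subseteq> {1..}" using j by auto
  have ES: "expectation ?S = (\<Sum>a\<in>{j..<j + k}. 2 * \<gamma> a)"
    using j by (subst Bochner_Integration.integral_sum)
      (auto intro!: sum.cong expectation_coordinate integrable_depends_on[OF fin] simp: depends_on_def)
  have "2 * t \<le> expectation ?S"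
  proof -
    have "(\<Sum>a\<in>{j..<j + k}. 2 * t / real k) \<le> (\<Sum>a\<in>{j..<j + k}. 2 * \<gamma> a)"
    proof (intro sum_mono)
      fix n assume "n \<in> {j..<j + k}"
      then have "t \<le> real k * \<gamma> n" using t(2) by auto
      then show "2 * t / real k \<le> 2 * \<gamma> n" using \<open>k > 0\<close> by (simp add: field_simps)
    qed
    then show ?thesis using \<open>k > 0\<close> by (simp add: ES)
  qed
  then have pt: "t\<^sup>2 * of_bool (?S x \<le> t) \<le> (?S x - expectation ?S)\<^sup>2" for x
  proof (cases "?S x \<le> t")
    case True
    have "\<bar>t\<bar> \<le> \<bar>?S x - expectation ?S\<bar>" using True \<open>2 * t \<le> _\<close> t(1) by linarith
    then show ?thesis using True by (simp add: abs_le_square_iff)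
  qed simp
  have "t\<^sup>2 * expectation (\<lambda>x. of_bool (?S x \<le> t)) = expectation (\<lambda>x. t\<^sup>2 * of_bool (?S x \<le> t))"
    by simp
  also have "\<dots> \<le> variance ?S"
    by (intro integral_mono pt integrable_depends_on[OF fin] depends_on_comp[OF d])
  also have "\<dots> \<le> real (card {j..<j + k}) * 2\<^sup>2"
  proof (rule variance_bounded_differences[OF fin d])
    fix a x u v assume a: "a \<in> {j..<j + k}" and uv: "u \<in> {-1, 1 :: int}" "v \<in> {-1, 1 :: int}"
    have "?S (x(a := u)) = real_of_int u + (\<Sum>b\<in>{j..<j + k} - {a}. real_of_int (x b))" for u
      by (subst sum.remove[OF _ a]) (auto intro!: sum.cong)
    then show "\<bar>?S (x(a := u)) - ?S (x(a := v))\<bar> \<le> 2" using uv by auto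
  qed
  finally show ?thesis using t(1) unfolding S by (simp add: field_simps)
qed

section \<open>Slow decay\<close>

lemma window_in_sign_words:
  assumes "x \<in> space \<nu>" "1 \<le> j"
  shows "map x [j..<j + k] \<in> sign_words k"
proof -
  have "x a \<in> {-1, 1}" if "a \<in> {j..<j + k}" for a
    using space_sign_productD[OF assms(1), of a] that assms(2) by auto
  then show ?thesis by (simp add: sign_words_def image_subset_iff)
qed

definition low_windows :: "real \<Rightarrow> nat \<Rightarrow> (nat \<Rightarrow> int) \<Rightarrow> real" where
  "low_windows t k x = (\<Sum>j\<in>{1..2 ^ k}. of_bool (real_of_int (sum_list (map x [j..<j + k])) \<le> t)) / 2 ^ k"

lemma integrable_low_window:
  "1 \<le> j \<Longrightarrow> integrable \<nu> (\<lambda>x. of_bool (real_of_int (sum_list (map x [j..<j + k])) \<le> t) :: real)"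
  by (rule integrable_depends_on[of "{j..<j + k}"])
     (auto intro!: depends_on_comp[of "\<lambda>x. map x [j..<j + k]"] depends_on_window)

lemma integrable_low_windows: "integrable \<nu> (low_windows t k)"
  unfolding low_windows_def
  by (intro integrable_divide_zero Bochner_Integration.integrable_sum integrable_low_window) auto

text \<open>An occurring word either has sum above \<open>t\<close>, which is rare for a uniform
  word, or is spelled by a low window; distinct words of the second kind are at most as numerous as
  low windows.\<close>

lemma prob_occurs_le:
  assumes x: "x \<in> space \<nu>" and t: "0 < t"
  shows "1 - measure_pmf.prob (pmf_of_set (sign_words k)) {w. occurrences x k w = 0}
    \<le> real k / t\<^sup>2 + low_windows t k x"
proof -
  let ?J = "{j \<in> {1..2 ^ k}. real_of_int (sum_list (map x [j..<j + k])) \<le> t}"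
  let ?Z = "sign_words k \<inter> {w. occurrences x k w = 0}"
  let ?B = "{w \<in> sign_words k. t < real_of_int (sum_list w)}"
  have "sign_words k \<subseteq> ?Z \<union> (?B \<union> (\<lambda>j. map x [j..<j + k]) ` ?J)"
  proof
    fix w assume w: "w \<in> sign_words k"
    show "w \<in> ?Z \<union> (?B \<union> (\<lambda>j. map x [j..<j + k]) ` ?J)"
    proof (cases "occurrences x k w = 0")
      case False
      then have "{j \<in> {1..2 ^ k}. map x [j..<j + k] = w} \<noteq> {}"
        unfolding occurrences_def by (metis card.empty)
      then obtain j where "j \<in> {1..2 ^ k}" "map x [j..<j + k] = w"
        by blast
      then have "t < real_of_int (sum_list w) \<or> j \<in> ?J" by auto
      then show ?thesis using w \<open>map x [j..<j + k] = w\<close> by blast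
    qed (use w in blast)
  qed
  then have "card (sign_words k) \<le> card (?Z \<union> (?B \<union> (\<lambda>j. map x [j..<j + k]) ` ?J))"
    by (intro card_mono) auto
  also have "\<dots> \<le> card ?Z + (card ?B + card ?J)"
    by (intro order_trans[OF card_Un_le] add_mono order_refl card_image_le) auto
  finally have "real (card (sign_words k)) \<le> real (card ?Z + (card ?B + card ?J))"
    by (rule of_nat_mono)
  then have "2 ^ k \<le> real (card ?Z) + (real (card ?B) + real (card ?J))"
    unfolding card_sign_words of_nat_add of_nat_power of_nat_numeral .
  also have "real (card ?J) = 2 ^ k * low_windows t k x"
    by (simp add: low_windows_def of_bool_def sum.If_cases Int_def)
  also have "real (card ?B) \<le> 2 ^ k * (real k / t\<^sup>2)"
    by (rule card_sum_list_gt[OF t])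
  finally have "2 ^ k * (1 - real (card ?Z) / 2 ^ k) \<le> 2 ^ k * (real k / t\<^sup>2 + low_windows t k x)"
    by (simp add: algebra_simps)
  then show ?thesis unfolding prob_sign_words by (simp only: mult_le_cancel_left_pos zero_less_power zero_less_numeral)
qed

text \<open>Starts below \<open>n0\<close> are bounded trivially by 1 each; Chebyshev handles the
  others.\<close>

lemma expectation_low_windows:
  assumes "0 < k" "0 < t"
    and t: "\<And>n. n0 \<le> n \<Longrightarrow> n \<le> 2 ^ k + k \<Longrightarrow> t \<le> real k * \<gamma> n"
  shows "expectation (low_windows t k) \<le> real n0 / 2 ^ k + 4 * real k / t\<^sup>2"
proof -
  let ?f = "\<lambda>j x. of_bool (real_of_int (sum_list (map x [j..<j + k])) \<le> t) :: real"
  have pt: "expectation (?f j) \<le> of_bool (j < n0) + 4 * real k / t\<^sup>2" if j: "j \<in> {1..2 ^ k}" for j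
  proof (cases "j < n0")
    case True
    have "expectation (?f j) \<le> expectation (\<lambda>x. 1)"
      using j by (intro integral_mono integrable_low_window) auto
    then show ?thesis using True assms(2) by (simp add: prob_space add_increasing2)
  next
    case False
    then show ?thesis
      using chebyshev_window_sum[of j k t] j assms by (auto intro!: t)
  qed
  have "expectation (low_windows t k) = (\<Sum>j\<in>{1..2 ^ k}. expectation (?f j)) / 2 ^ k"
    unfolding low_windows_def
    by (subst integral_divide_zero, subst Bochner_Integration.integral_sum)
       (auto intro: integrable_low_window)
  also have "\<dots> \<le> (\<Sum>j\<in>{1..2 ^ k}. of_bool (j < n0) + 4 * real k / t\<^sup>2) / 2 ^ k"
    by (intro divide_right_mono sum_mono pt) auto
  also have "\<dots> = real (card {j \<in> {1..2 ^ k}. j < n0}) / 2 ^ k + 4 * real k / t\<^sup>2"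
    by (simp add: sum.distrib of_bool_def sum.If_cases Int_def add_divide_distrib)
  also have "card {j \<in> {1..2 ^ k}. j < n0} \<le> card {..<n0}"
    by (intro card_mono) auto
  finally show ?thesis by (simp add: divide_right_mono)
qed

text \<open>The expected share of low windows tends to 0, so along a subsequence it does so almost
  surely. There the probability of no occurrence tends to 1, contradicting the required limit 1/e;
  one subsequence is enough.\<close>

theorem AE_not_simply_poisson_generic:
  assumes \<delta>: "0 < \<delta>" and ev: "\<forall>\<^sub>F n in sequentially. \<gamma> n = ln (real n) powr (- (1/2 - \<delta>))"
  shows "AE x in \<nu>. \<not> simply_poisson_generic x"
proof -
  define \<beta> where "\<beta> = 1/2 - \<delta>"
  from ev obtain n1 where n1: "\<And>n. n1 \<le> n \<Longrightarrow> \<gamma> n = ln (real n) powr (- \<beta>)"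
    unfolding eventually_sequentially \<beta>_def by blast
  \<comment> \<open>From 3 on, \<open>ln n\<close> is at least 1.\<close>
  define n0 where "n0 = max 3 n1"
  have n0: "\<gamma> n = ln (real n) powr (- \<beta>)" "3 \<le> n" if "n0 \<le> n" for n
    using that n1 by (auto simp: n0_def)
  \<comment> \<open>A nonpositive \<open>\<beta>\<close> would force a bias of at least 1 at
    \<open>n0\<close>. Positivity makes the bias decrease with \<open>n\<close>, as
    \<open>t_le\<close> requires.\<close>
  have "0 < \<beta>"
  proof (rule ccontr)
    assume "\<not> 0 < \<beta>"
    have "1 \<le> ln (real n0)"
      using exp_le n0(2)[of n0] by (subst ln_ge_iff) auto
    then have "1 \<le> ln (real n0) powr (- \<beta>)"
      using \<open>\<not> 0 < \<beta>\<close> by (intro ge_one_powr_ge_zero) auto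
    then show False using n0(1)[of n0] bias[of n0] by simp
  qed
  have "\<beta> < 1/2" using \<delta> by (simp add: \<beta>_def)
  \<comment> \<open>Window coordinates satisfy n \<le> 2^k + k \<le> 2^(k+1), so ln n \<le> k + 1:
    this is a lower bound for \<open>k\<close> times any bias they carry, up to the initial segment
    below \<open>n0\<close>.\<close>
  define t where "t k = real k * real (k + 1) powr (- \<beta>)" for k
  have tpos: "0 < t k" if "0 < k" for k using that by (simp add: t_def)
  have t_le: "t k \<le> real k * \<gamma> n" if k: "0 < k" and n: "n0 \<le> n" "n \<le> 2 ^ k + k" for k n
  proof -
    have "n \<le> 2 ^ (k + 1)" using n(2) less_exp[of k] unfolding power_add power_one_right by linarith
    then have "real n \<le> 2 ^ (k + 1)" by (metis of_nat_le_iff of_nat_numeral of_nat_power)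
    then have "ln (real n) \<le> ln (2 ^ (k + 1))" using n0(2)[OF n(1)] by (subst ln_le_cancel_iff) auto
    also have "\<dots> = real (k + 1) * ln 2" by (rule ln_realpow)
    also have "\<dots> \<le> real (k + 1) * 1" using ln_2_less_1 by (intro mult_left_mono) auto
    finally have "real (k + 1) powr (- \<beta>) \<le> ln (real n) powr (- \<beta>)"
      using \<open>0 < \<beta>\<close> n0(2)[OF n(1)] by (intro powr_mono2') auto
    then show ?thesis unfolding t_def n0(1)[OF n(1)] by (intro mult_left_mono) auto
  qed
  \<comment> \<open>The quotient equals (k+1)^(2\<beta>) / k. The factor 2 replaces the denominator
    by k + 1, and the exponent 2\<beta> - 1 is negative.\<close>
  have rate: "(\<lambda>k. real k / (t k)\<^sup>2) \<longlonglongrightarrow> 0"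
  proof (rule tendsto_sandwich[OF _ _ tendsto_const])
    show "\<forall>\<^sub>F k in sequentially. 0 \<le> real k / (t k)\<^sup>2" by simp
    show "\<forall>\<^sub>F k in sequentially. real k / (t k)\<^sup>2 \<le> 2 * real (k + 1) powr (- (1 - 2 * \<beta>))"
      using eventually_gt_at_top[of 0]
    proof eventually_elim
      case (elim k)
      have "(t k)\<^sup>2 = (real k)\<^sup>2 * real (k + 1) powr (- 2 * \<beta>)"
        by (simp add: t_def power_mult_distrib power2_eq_square powr_add[symmetric])
      then have "real k / (t k)\<^sup>2 = real (k + 1) powr (2 * \<beta>) / real k"
        using elim by (simp only:) (simp add: powr_minus field_simps power2_eq_square)
      also have "\<dots> \<le> 2 * real (k + 1) powr (2 * \<beta>) / real (k + 1)"
        using elim by (simp add: field_simps)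
      also have "\<dots> = 2 * real (k + 1) powr (- (1 - 2 * \<beta>))"
        by (simp add: powr_diff)
      finally show ?case .
    qed
    have "(\<lambda>k. real (k + 1) powr (- (1 - 2 * \<beta>))) \<longlonglongrightarrow> 0"
      using \<open>\<beta> < 1/2\<close>
      by (intro tendsto_neg_powr filterlim_compose[OF filterlim_real_sequentially] filterlim_add_const_nat_at_top)
         auto
    from tendsto_mult[OF tendsto_const[of 2] this]
    show "(\<lambda>k. 2 * real (k + 1) powr (- (1 - 2 * \<beta>))) \<longlonglongrightarrow> 0" by simp
  qed
  let ?Y = "\<lambda>k. low_windows (t k) k"
  have Y_nonneg: "0 \<le> ?Y k x" for k x unfolding low_windows_def by (intro divide_nonneg_nonneg sum_nonneg) auto
  have "(\<lambda>k. expectation (\<lambda>x. norm (?Y k x))) \<longlonglongrightarrow> 0"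
  proof (rule tendsto_sandwich[OF _ _ tendsto_const])
    show "\<forall>\<^sub>F k in sequentially. 0 \<le> expectation (\<lambda>x. norm (?Y k x))" by (simp add: integral_nonneg_AE)
    show "\<forall>\<^sub>F k in sequentially. expectation (\<lambda>x. norm (?Y k x)) \<le> real n0 * (1/2) ^ k + 4 * (real k / (t k)\<^sup>2)"
      using eventually_gt_at_top[of 0]
    proof eventually_elim
      case (elim k)
      show ?case
        using expectation_low_windows[OF elim tpos[OF elim] t_le[OF elim], of n0]
        by (simp add: Y_nonneg power_divide)
    qed
    show "(\<lambda>k. real n0 * (1/2) ^ k + 4 * (real k / (t k)\<^sup>2)) \<longlonglongrightarrow> 0"
      by (rule tendsto_eq_intros LIMSEQ_realpow_zero rate refl | simp)+
  qed
  from tendsto_L1_AE_subseq[OF integrable_low_windows this]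
  obtain r where r: "strict_mono r" "AE x in \<nu>. (\<lambda>n. ?Y (r n) x) \<longlonglongrightarrow> 0" by blast
  from r(2) AE_space show ?thesis
  proof eventually_elim
    case (elim x)
    show ?case
    proof
      assume "simply_poisson_generic x"
      then have "(\<lambda>k. measure_pmf.prob (pmf_of_set (sign_words k)) {w. occurrences x k w = 0}) \<longlonglongrightarrow> 1 / (exp 1 * fact 0)"
        unfolding simply_poisson_generic_def by blast
      from LIMSEQ_subseq_LIMSEQ[OF this r(1)]
      have 1: "(\<lambda>n. 1 - measure_pmf.prob (pmf_of_set (sign_words (r n))) {w. occurrences x (r n) w = 0})
          \<longlonglongrightarrow> 1 - 1 / exp 1"
        by (intro tendsto_diff tendsto_const) (simp add: comp_def)
      have 2: "(\<lambda>n. real (r n) / (t (r n))\<^sup>2 + ?Y (r n) x) \<longlonglongrightarrow> 0 + 0"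
        using LIMSEQ_subseq_LIMSEQ[OF rate r(1)] elim(1) by (intro tendsto_add) (simp_all add: comp_def)
      have "\<exists>N. \<forall>n\<ge>N. 1 - measure_pmf.prob (pmf_of_set (sign_words (r n))) {w. occurrences x (r n) w = 0}
          \<le> real (r n) / (t (r n))\<^sup>2 + ?Y (r n) x"
      proof (intro exI[of _ 1] allI impI)
        fix n :: nat assume "1 \<le> n"
        then have "0 < r n" using seq_suble[OF r(1), of n] by simp
        from prob_occurs_le[OF elim(2) tpos[OF this]]
        show "1 - measure_pmf.prob (pmf_of_set (sign_words (r n))) {w. occurrences x (r n) w = 0}
          \<le> real (r n) / (t (r n))\<^sup>2 + ?Y (r n) x" .
      qed
      from LIMSEQ_le[OF 1 2 this] have "1 \<le> 1 / exp (1 :: real)" by simp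
      then show False by (simp add: field_simps)
    qed
  qed
qed

section \<open>Poisson approximation for a fixed word\<close>

text \<open>For \<open>w\<close> in \<open>sign_words k\<close> and \<open>j \<ge> 1\<close>, the
  probability that the window at \<open>j\<close> spells \<open>w\<close>, kept as a product so that
  sums over words factor.\<close>

definition word_weight :: "nat \<Rightarrow> nat \<Rightarrow> int list \<Rightarrow> real" where
  "word_weight k j w = (\<Prod>i<k. weight (\<gamma> (j + i)) (w ! i))"

lemma word_weight_nonneg: "0 \<le> word_weight k j w"
  unfolding word_weight_def by (intro prod_nonneg) simp

lemma expectation_window:
  assumes "1 \<le> j" "w \<in> sign_words k"
  shows "expectation (\<lambda>x. of_bool (map x [j..<j + k] = w)) = word_weight k j w"
  using expectation_mult_window[of "{}" "\<lambda>x. 1" j k w] assms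
  by (simp add: depends_on_const word_weight_def prob_space)

text \<open>The starts in \<open>J\<close> of windows overlapping the one at \<open>j\<close>,
  written without natural subtraction; \<open>j\<close> itself belongs when it is in
  \<open>J\<close> and \<open>k > 0\<close>.\<close>

definition neighbours :: "nat set \<Rightarrow> nat \<Rightarrow> nat \<Rightarrow> nat set" where
  "neighbours J k j = {i \<in> J. i < j + k \<and> j < i + k}"

lemma neighbours_subset: "neighbours J k j \<subseteq> J"
  by (auto simp: neighbours_def)

lemma card_neighbours: "card (neighbours J k j) \<le> 2 * k"
proof -
  have "card (neighbours J k j) \<le> card {j + 1 - k..<j + k}"
    by (intro card_mono) (auto simp: neighbours_def)
  also have "\<dots> \<le> 2 * k" by simp
  finally show ?thesis .
qed

text \<open>
  Stein's method for locally dependent indicators: windows at distance at least \<open>k\<close> are independent,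
  so removing the neighbours of \<open>j\<close> decouples the count from the window at \<open>j\<close>.
\<close>

lemma window_count_poisson_approximation:
  assumes J: "finite J" "J \<subseteq> {1..}" and k: "0 < k" and w: "w \<in> sign_words k"
  shows "\<bar>expectation (\<lambda>x. of_bool (window_count J k x w = n)) - 1 / (exp 1 * fact n)\<bar> \<le>
    exp 1 * \<bar>1 - (\<Sum>j\<in>J. word_weight k j w)\<bar> +
    2 * exp 1 * (\<Sum>j\<in>J. (\<Sum>i\<in>neighbours J k j. word_weight k j w * word_weight k i w) +
       (\<Sum>i\<in>neighbours J k j - {j}.
          expectation (\<lambda>x. of_bool (map x [j..<j + k] = w) * of_bool (map x [i..<i + k] = w))))"
proof -
  obtain g :: "nat \<Rightarrow> real" where g: "\<And>m. \<bar>g m\<bar> \<le> exp 1"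
    and stein: "\<And>m. g (Suc m) - real m * g m = of_bool (m = n) - 1 / (exp 1 * fact n)"
    using poisson_stein_solution[of n] by blast
  define A where "A = (\<Union>j\<in>J. {j..<j + k})"
  have A: "finite A" "A \<subseteq> {1..}" using J by (auto simp: A_def)
  let ?I = "\<lambda>j x. of_bool (map x [j..<j + k] = w) :: real"
  let ?M = "\<lambda>x. window_count J k x w"
  let ?N = "neighbours J k"
  let ?R = "\<lambda>j x. window_count (J - ?N j) k x w"
  let ?p = "\<lambda>j. word_weight k j w"
  define L where "L = (\<Sum>j\<in>J. ?p j)"
  have dI: "depends_on (?I j) A" if "j \<in> J" for j
    using that by (intro depends_on_comp[OF depends_on_window]) (auto simp: A_def)
  have dM: "depends_on ?M A" by (rule depends_on_window_count) (auto simp: A_def)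
  have dR: "depends_on (?R j) A" for j by (rule depends_on_window_count) (auto simp: A_def)
  note int = integrable_depends_on[OF A]
  have iI: "integrable \<nu> (?I j)" if "j \<in> J" for j by (rule int[OF dI[OF that]])
  have iII: "integrable \<nu> (\<lambda>x. ?I j x * ?I i x)" if "j \<in> J" "i \<in> J" for i j
    by (rule int[OF depends_on_comp2[OF dI[OF that(1)] dI[OF that(2)]]])
  have igM: "integrable \<nu> (\<lambda>x. g (Suc (?M x)))" by (rule int[OF depends_on_comp[OF dM]])
  have igR: "integrable \<nu> (\<lambda>x. g (Suc (?R j x)))" for j by (rule int[OF depends_on_comp[OF dR]])
  have iIM: "integrable \<nu> (\<lambda>x. ?I j x * g (?M x))" if "j \<in> J" for j
    by (rule int[OF depends_on_comp2[OF dI[OF that] dM, of "\<lambda>p q. p * g q"]])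
  have iIR: "integrable \<nu> (\<lambda>x. ?I j x * g (Suc (?R j x)))" if "j \<in> J" for j
    by (rule int[OF depends_on_comp2[OF dI[OF that] dR, of "\<lambda>p q. p * g (Suc q)"]])
  have M_split: "?M x = window_count (?N j) k x w + ?R j x" for x j
    using window_count_Un[of "?N j" "J - ?N j" k x w] J(1) neighbours_subset[of J k j]
    by (simp add: finite_subset Un_absorb1)
  have finN: "finite (?N j)" for j using J(1) neighbours_subset by (rule finite_subset[rotated])
  have EI: "expectation (?I j) = ?p j" if "j \<in> J" for j
    using that J(2) w by (intro expectation_window) auto
  have g2: "\<bar>g a - g b\<bar> \<le> 2 * exp 1" for a b using g[of a] g[of b] by linarith

  \<comment> \<open>When the window at \<open>j\<close> matches and no other neighbour does,
    \<open>?M x\<close> is \<open>Suc (?R j x)\<close> and the difference vanishes. Otherwise either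
    the left side is 0 or there is a further match, while \<open>g\<close> varies by at most
    2e.\<close>
  have b1: "\<bar>expectation (\<lambda>x. ?I j x * g (?M x)) - expectation (\<lambda>x. ?I j x * g (Suc (?R j x)))\<bar>
      \<le> 2 * exp 1 * (\<Sum>i\<in>?N j - {j}. expectation (\<lambda>x. ?I j x * ?I i x))" if j: "j \<in> J" for j
  proof -
    have jN: "j \<in> ?N j" using j k by (simp add: neighbours_def)
    have "\<bar>?I j x * g (?M x) - ?I j x * g (Suc (?R j x))\<bar> \<le> 2 * exp 1 * (\<Sum>i\<in>?N j - {j}. ?I j x * ?I i x)" for x
    proof (cases "?I j x = 1 \<and> (\<Sum>i\<in>?N j - {j}. ?I i x) = 0")
      case True
      have "real (window_count (?N j) k x w) = 1"
        unfolding window_count_eq_sum[OF finN] by (subst sum.remove[OF finN jN]) (use True in simp)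
      then show ?thesis using M_split[of x j] by (simp add: sum_nonneg)
    next
      case False
      show ?thesis
      proof (cases "?I j x = 1")
        case True
        with False have "(\<Sum>i\<in>?N j - {j}. ?I i x) \<noteq> 0" by simp
        then obtain i where "i \<in> ?N j - {j}" "?I i x \<noteq> 0" by (meson sum.not_neutral_contains_not_neutral)
        then have "1 \<le> (\<Sum>i\<in>?N j - {j}. ?I i x)"
          using member_le_sum[of i "?N j - {j}" "\<lambda>i. ?I i x"] finN by (auto split: if_splits simp: of_bool_def)
        then have "2 * exp 1 * 1 \<le> 2 * exp 1 * (\<Sum>i\<in>?N j - {j}. ?I i x)"
          by (intro mult_left_mono) auto
        then have "\<bar>g (?M x) - g (Suc (?R j x))\<bar> \<le> 2 * exp 1 * (\<Sum>i\<in>?N j - {j}. ?I i x)"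
          using g2[of "?M x" "Suc (?R j x)"] by linarith
        then show ?thesis unfolding True by simp
      next
        case False
        then show ?thesis by simp
      qed
    qed
    note pt = this
    have "\<bar>expectation (\<lambda>x. ?I j x * g (?M x)) - expectation (\<lambda>x. ?I j x * g (Suc (?R j x)))\<bar>
        = \<bar>expectation (\<lambda>x. ?I j x * g (?M x) - ?I j x * g (Suc (?R j x)))\<bar>"
      using iIM[OF j] iIR[OF j] by (subst Bochner_Integration.integral_diff) auto
    also have "\<dots> \<le> expectation (\<lambda>x. \<bar>?I j x * g (?M x) - ?I j x * g (Suc (?R j x))\<bar>)"
      by (rule integral_abs_bound)
    also have "\<dots> \<le> expectation (\<lambda>x. 2 * exp 1 * (\<Sum>i\<in>?N j - {j}. ?I j x * ?I i x))"
      using iIM[OF j] iIR[OF j] iII[OF j] neighbours_subset[of J k j]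
      by (intro integral_mono pt integrable_abs Bochner_Integration.integrable_diff
            integrable_mult_right Bochner_Integration.integrable_sum) auto
    also have "\<dots> = 2 * exp 1 * (\<Sum>i\<in>?N j - {j}. expectation (\<lambda>x. ?I j x * ?I i x))"
      using iII[OF j] neighbours_subset[of J k j]
      by (subst integral_mult_right_zero, subst Bochner_Integration.integral_sum) auto
    finally show ?thesis .
  qed

  \<comment> \<open>\<open>?R j\<close> counts only windows disjoint from the one at
    \<open>j\<close>, so the factors are independent.\<close>
  have b2: "expectation (\<lambda>x. ?I j x * g (Suc (?R j x))) = ?p j * expectation (\<lambda>x. g (Suc (?R j x)))"
    if j: "j \<in> J" for j
  proof -
    let ?B = "\<Union>i\<in>J - ?N j. {i..<i + k}"
    have "depends_on (?R j) ?B" by (rule depends_on_window_count) auto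
    then have d: "depends_on (\<lambda>x. g (Suc (?R j x))) ?B" by (rule depends_on_comp)
    have "expectation (\<lambda>x. g (Suc (?R j x)) * ?I j x) = expectation (\<lambda>x. g (Suc (?R j x))) * ?p j"
      unfolding word_weight_def
      by (rule expectation_mult_window[OF _ _ d]) (use J j w in \<open>auto simp: neighbours_def\<close>)
    then show ?thesis by (simp add: mult.commute)
  qed

  \<comment> \<open>\<open>?R j\<close> and \<open>?M\<close> differ only if some neighbour
    matches.\<close>
  have b3: "\<bar>expectation (\<lambda>x. g (Suc (?R j x))) - expectation (\<lambda>x. g (Suc (?M x)))\<bar>
     \<le> 2 * exp 1 * (\<Sum>i\<in>?N j. ?p i)" for j
  proof -
    have pt: "\<bar>g (Suc (?R j x)) - g (Suc (?M x))\<bar> \<le> 2 * exp 1 * (\<Sum>i\<in>?N j. ?I i x)" for x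
    proof (cases "window_count (?N j) k x w = 0")
      case True
      then show ?thesis using M_split[of x j] by (simp add: sum_nonneg)
    next
      case False
      then have "1 \<le> real (window_count (?N j) k x w)" by simp
      then have "2 * exp 1 * 1 \<le> 2 * exp 1 * (\<Sum>i\<in>?N j. ?I i x)"
        unfolding window_count_eq_sum[OF finN] by (intro mult_left_mono) auto
      then show ?thesis using g2[of "Suc (?R j x)" "Suc (?M x)"] by linarith
    qed
    have "\<bar>expectation (\<lambda>x. g (Suc (?R j x))) - expectation (\<lambda>x. g (Suc (?M x)))\<bar>
        = \<bar>expectation (\<lambda>x. g (Suc (?R j x)) - g (Suc (?M x)))\<bar>"
      using igM igR[of j] by (subst Bochner_Integration.integral_diff) auto
    also have "\<dots> \<le> expectation (\<lambda>x. \<bar>g (Suc (?R j x)) - g (Suc (?M x))\<bar>)"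
      by (rule integral_abs_bound)
    also have "\<dots> \<le> expectation (\<lambda>x. 2 * exp 1 * (\<Sum>i\<in>?N j. ?I i x))"
      using igM igR[of j] iI neighbours_subset[of J k j]
      by (intro integral_mono pt integrable_abs Bochner_Integration.integrable_diff
            integrable_mult_right Bochner_Integration.integrable_sum) auto
    also have "\<dots> = 2 * exp 1 * (\<Sum>i\<in>?N j. expectation (?I i))"
      using iI neighbours_subset[of J k j]
      by (subst integral_mult_right_zero, subst Bochner_Integration.integral_sum) auto
    also have "(\<Sum>i\<in>?N j. expectation (?I i)) = (\<Sum>i\<in>?N j. ?p i)"
      using neighbours_subset[of J k j] by (intro sum.cong EI) auto
    finally show ?thesis .
  qed

  have sz: "expectation (\<lambda>x. real (?M x) * g (?M x)) = (\<Sum>j\<in>J. expectation (\<lambda>x. ?I j x * g (?M x)))"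
    unfolding window_count_eq_sum[OF J(1)] sum_distrib_right
    by (rule Bochner_Integration.integral_sum) (rule iIM)
  let ?G = "expectation (\<lambda>x. g (Suc (?M x)))"
  have factor: "p * (c * s) + c * u = c * (p * s + u)" for p c s u :: real
    by (simp add: algebra_simps)
  have summand: "\<bar>?p j * ?G - expectation (\<lambda>x. ?I j x * g (?M x))\<bar> \<le>
     2 * exp 1 * ((\<Sum>i\<in>?N j. ?p j * ?p i) + (\<Sum>i\<in>?N j - {j}. expectation (\<lambda>x. ?I j x * ?I i x)))"
    if j: "j \<in> J" for j
  proof -
    have eq: "?p j * ?G - expectation (\<lambda>x. ?I j x * g (?M x)) =
       ?p j * (?G - expectation (\<lambda>x. g (Suc (?R j x)))) +
       (expectation (\<lambda>x. ?I j x * g (Suc (?R j x))) - expectation (\<lambda>x. ?I j x * g (?M x)))"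
      unfolding b2[OF j] by (simp add: algebra_simps)
    have "\<bar>?p j * ?G - expectation (\<lambda>x. ?I j x * g (?M x))\<bar> \<le>
        ?p j * (2 * exp 1 * (\<Sum>i\<in>?N j. ?p i)) +
        2 * exp 1 * (\<Sum>i\<in>?N j - {j}. expectation (\<lambda>x. ?I j x * ?I i x))"
      unfolding eq using b1[OF j] b3[of j] word_weight_nonneg[of k j w]
      by (intro order_trans[OF abs_triangle_ineq] add_mono)
         (auto simp: abs_mult abs_minus_commute intro!: mult_left_mono)
    also have "\<dots> = 2 * exp 1 * (?p j * (\<Sum>i\<in>?N j. ?p i) +
        (\<Sum>i\<in>?N j - {j}. expectation (\<lambda>x. ?I j x * ?I i x)))"
      by (rule factor)
    finally show ?thesis unfolding sum_distrib_left[of "?p j"] .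
  qed
  have "expectation (\<lambda>x. of_bool (?M x = n)) - 1 / (exp 1 * fact n :: real)
      = expectation (\<lambda>x. of_bool (?M x = n) - 1 / (exp 1 * fact n))"
    using int[OF depends_on_comp[OF dM, of "\<lambda>m. of_bool (m = n)"]]
    by (subst Bochner_Integration.integral_diff) (simp_all add: prob_space)
  also have "\<dots> = expectation (\<lambda>x. g (Suc (?M x)) - real (?M x) * g (?M x))"
    unfolding stein ..
  also have "\<dots> = ?G - (\<Sum>j\<in>J. expectation (\<lambda>x. ?I j x * g (?M x)))"
    unfolding sz[symmetric]
    by (rule Bochner_Integration.integral_diff[OF igM int[OF depends_on_comp[OF dM]]])
  \<comment> \<open>Adding and subtracting \<open>L * ?G\<close> separates the deviation of the mean
    count from 1 from the local dependence errors.\<close>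
  also have "\<dots> = (1 - L) * ?G + (\<Sum>j\<in>J. ?p j * ?G - expectation (\<lambda>x. ?I j x * g (?M x)))"
  proof -
    have "(\<Sum>j\<in>J. ?p j * ?G) = L * ?G" unfolding L_def by (rule sum_distrib_right[symmetric])
    then show ?thesis unfolding sum_subtractf by (simp add: left_diff_distrib)
  qed
  finally have diff: "expectation (\<lambda>x. of_bool (?M x = n)) - 1 / (exp 1 * fact n) =
    (1 - L) * ?G + (\<Sum>j\<in>J. ?p j * ?G - expectation (\<lambda>x. ?I j x * g (?M x)))" .
  have "\<bar>?G\<bar> \<le> expectation (\<lambda>x. \<bar>g (Suc (?M x))\<bar>)" by (rule integral_abs_bound)
  also have "\<dots> \<le> expectation (\<lambda>x. exp 1)"
    by (intro integral_mono g integrable_abs igM) auto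
  finally have "\<bar>?G\<bar> \<le> exp 1" by (simp add: prob_space)
  then have "\<bar>(1 - L) * ?G\<bar> \<le> exp 1 * \<bar>1 - L\<bar>"
    unfolding abs_mult mult.commute[of "exp 1"] by (intro mult_left_mono) auto
  moreover have "\<bar>\<Sum>j\<in>J. ?p j * ?G - expectation (\<lambda>x. ?I j x * g (?M x))\<bar> \<le>
      2 * exp 1 * (\<Sum>j\<in>J. (\<Sum>i\<in>?N j. ?p j * ?p i) + (\<Sum>i\<in>?N j - {j}. expectation (\<lambda>x. ?I j x * ?I i x)))"
    unfolding sum_distrib_left[of "2 * exp 1"] by (intro order_trans[OF sum_abs] sum_mono summand)
  ultimately show ?thesis
    unfolding diff L_def[symmetric] by (rule order_trans[OF abs_triangle_ineq add_mono])
qed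

section \<open>Averaging over words and concentration\<close>

lemma sum_word_weight: "(\<Sum>w\<in>sign_words k. word_weight k j w) = 1"
  unfolding word_weight_def by (subst sum_prod_sign_words) simp

lemma word_weight_le:
  assumes "\<And>n. m \<le> n \<Longrightarrow> \<bar>\<gamma> n\<bar> \<le> \<epsilon>" "m \<le> j"
  shows "word_weight k j w \<le> (1/2 + \<epsilon>) ^ k"
proof -
  have "word_weight k j w \<le> (\<Prod>i<k. 1/2 + \<epsilon>)"
    unfolding word_weight_def
  proof (intro prod_mono conjI weight_nonneg)
    fix i show "weight (\<gamma> (j + i)) (w ! i) \<le> 1/2 + \<epsilon>"
      using assms(1)[of "j + i"] assms(2) by (auto simp: weight_def)
  qed
  then show ?thesis by simp
qed

text \<open>The sum over words factors, and (1/2 + a)(1/2 + b) + (1/2 - a)(1/2 - b) = 1/2 + 2ab in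
  each coordinate. First-order terms in the biases cancel.\<close>

lemma sum_word_weight_mult_le:
  assumes "\<And>n. m \<le> n \<Longrightarrow> \<bar>\<gamma> n\<bar> \<le> \<epsilon>" "m \<le> i" "m \<le> j"
  shows "(\<Sum>w\<in>sign_words k. word_weight k i w * word_weight k j w) \<le> (1/2 + 2 * \<epsilon>\<^sup>2) ^ k"
proof -
  have "(\<Sum>w\<in>sign_words k. word_weight k i w * word_weight k j w) =
     (\<Sum>w\<in>sign_words k. \<Prod>l<k. weight (\<gamma> (i + l)) (w ! l) * weight (\<gamma> (j + l)) (w ! l))"
    by (simp add: word_weight_def prod.distrib)
  also have "\<dots> = (\<Prod>l<k. weight (\<gamma> (i + l)) 1 * weight (\<gamma> (j + l)) 1 + weight (\<gamma> (i + l)) (-1) * weight (\<gamma> (j + l)) (-1))"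
    by (rule sum_prod_sign_words)
  also have "\<dots> \<le> (\<Prod>l<k. 1/2 + 2 * \<epsilon>\<^sup>2)"
  proof (intro prod_mono conjI add_nonneg_nonneg mult_nonneg_nonneg weight_nonneg)
    fix l
    have "\<gamma> (i + l) * \<gamma> (j + l) \<le> \<bar>\<gamma> (i + l)\<bar> * \<bar>\<gamma> (j + l)\<bar>"
      by (metis abs_ge_self abs_mult)
    also have "\<dots> \<le> \<epsilon> * \<epsilon>"
      using assms by (intro mult_mono) (auto intro: order_trans[OF abs_ge_zero[of "\<gamma> (i + l)"]])
    finally show "weight (\<gamma> (i + l)) 1 * weight (\<gamma> (j + l)) 1 + weight (\<gamma> (i + l)) (-1) * weight (\<gamma> (j + l)) (-1)
       \<le> 1/2 + 2 * \<epsilon>\<^sup>2"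
      by (simp add: weight_def algebra_simps power2_eq_square)
  qed
  finally show ?thesis by simp
qed

text \<open>Two given windows agree on at most one word, so summing over words gives the probability
  that the windows are equal, with no factor 2^k.\<close>

lemma sum_expectation_two_windows_le:
  assumes \<epsilon>: "\<And>n. m \<le> n \<Longrightarrow> \<bar>\<gamma> n\<bar> \<le> \<epsilon>" and ij: "m \<le> i" "m \<le> j" "i \<noteq> j" "1 \<le> m"
  shows "(\<Sum>w\<in>sign_words k. expectation (\<lambda>x. of_bool (map x [i..<i + k] = w) * of_bool (map x [j..<j + k] = w)))
    \<le> (1/2 + \<epsilon>) ^ k"
proof -
  have dep: "depends_on (\<lambda>x :: nat \<Rightarrow> int. of_bool (map x [l..<l + k] = w) :: real) ({i..<i + k} \<union> {j..<j + k})"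
    if "l \<in> {i, j}" for l w
    using that by (intro depends_on_comp[OF depends_on_window]) auto
  have fin: "finite ({i..<i + k} \<union> {j..<j + k})" "{i..<i + k} \<union> {j..<j + k} \<subseteq> {1..}" using ij by auto
  have "integrable \<nu> (\<lambda>x. of_bool (map x [i..<i + k] = w) * of_bool (map x [j..<j + k] = w) :: real)" for w
    by (rule integrable_depends_on[OF fin depends_on_comp2[OF dep dep]]) auto
  then have "(\<Sum>w\<in>sign_words k. expectation (\<lambda>x. of_bool (map x [i..<i + k] = w) * of_bool (map x [j..<j + k] = w))) =
    expectation (\<lambda>x. \<Sum>w\<in>sign_words k. of_bool (map x [i..<i + k] = w) * of_bool (map x [j..<j + k] = w) :: real)"
    by (intro Bochner_Integration.integral_sum[symmetric])
  also have "\<dots> = expectation (\<lambda>x. of_bool (map x [i..<i + k] = map x [j..<j + k]))"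
  proof (rule Bochner_Integration.integral_cong[OF refl])
    fix x assume x: "x \<in> space \<nu>"
    have "(\<Sum>w\<in>sign_words k. of_bool (map x [i..<i + k] = w) * of_bool (map x [j..<j + k] = w)) =
       (\<Sum>w\<in>sign_words k. if w = map x [i..<i + k] then of_bool (map x [j..<j + k] = w) else 0 :: real)"
      by (intro sum.cong) auto
    also have "\<dots> = of_bool (map x [i..<i + k] = map x [j..<j + k])"
      using window_in_sign_words[OF x, of i k] ij by (subst sum.delta) auto
    finally show "(\<Sum>w\<in>sign_words k. of_bool (map x [i..<i + k] = w) * of_bool (map x [j..<j + k] = w)) =
       (of_bool (map x [i..<i + k] = map x [j..<j + k]) :: real)" .
  qed
  also have "\<dots> \<le> (1/2 + \<epsilon>) ^ k"
  proof -
    have "0 \<le> \<epsilon>" using \<epsilon>[of m] by linarith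
    consider "i < j" | "j < i" using ij(3) by linarith
    then show ?thesis
    proof cases
      case 1
      then show ?thesis
        using expectation_repeated_window[of i "j - i" \<epsilon> k] \<epsilon> ij \<open>0 \<le> \<epsilon>\<close> by auto
    next
      case 2
      then show ?thesis
        using expectation_repeated_window[of j "i - j" \<epsilon> k] \<epsilon> ij \<open>0 \<le> \<epsilon>\<close>
        by (auto simp: eq_commute[of "map _ [i..<_]"])
    qed
  qed
  finally show ?thesis .
qed

text \<open>Cauchy--Schwarz reduces to the first two moments of the mean count of a word: the first
  moments sum to \<open>card J\<close>, the squares to at most 2^k (1 + 4\<epsilon>^2)^k. The
  radicand is small when \<open>J\<close> is almost everything and k \<epsilon>^2 is small.\<close>

lemma sum_abs_mean_count_le:
  assumes \<epsilon>: "\<And>n. m \<le> n \<Longrightarrow> \<bar>\<gamma> n\<bar> \<le> \<epsilon>"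
    and J: "J \<subseteq> {m..2 ^ k}" "1 \<le> m"
  shows "(\<Sum>w\<in>sign_words k. \<bar>1 - (\<Sum>j\<in>J. word_weight k j w)\<bar>)
    \<le> 2 ^ k * sqrt (1 - 2 * (real (card J) / 2 ^ k) + exp (4 * real k * \<epsilon>\<^sup>2))"
proof -
  have finJ: "finite J" using J(1) by (rule finite_subset) simp
  let ?L = "\<lambda>w. \<Sum>j\<in>J. word_weight k j w"
  let ?r = "real (card J) / 2 ^ k"
  have "card J \<le> card {1..2 ^ k :: nat}" using J by (intro card_mono) auto
  then have "card J \<le> 2 ^ k" by simp
  then have "real (card J) \<le> 2 ^ k" by (metis of_nat_mono of_nat_numeral of_nat_power)
  then have r1: "?r \<le> 1" by simp
  have s1: "(\<Sum>w\<in>sign_words k. ?L w) = real (card J)"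
    by (subst sum.swap) (simp add: sum_word_weight)
  have "(\<Sum>w\<in>sign_words k. (?L w)\<^sup>2) =
     (\<Sum>w\<in>sign_words k. \<Sum>i\<in>J. \<Sum>j\<in>J. word_weight k i w * word_weight k j w)"
    by (simp add: power2_eq_square sum_product)
  also have "\<dots> = (\<Sum>i\<in>J. \<Sum>w\<in>sign_words k. \<Sum>j\<in>J. word_weight k i w * word_weight k j w)"
    by (rule sum.swap)
  also have "\<dots> = (\<Sum>i\<in>J. \<Sum>j\<in>J. \<Sum>w\<in>sign_words k. word_weight k i w * word_weight k j w)"
    by (intro sum.cong refl sum.swap)
  also have "\<dots> \<le> (\<Sum>i\<in>J. \<Sum>j\<in>J. (1/2 + 2 * \<epsilon>\<^sup>2) ^ k)"
    using J by (intro sum_mono sum_word_weight_mult_le[OF \<epsilon>]) auto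
  also have "\<dots> = 2 ^ k * (?r\<^sup>2 * (1 + 4 * \<epsilon>\<^sup>2) ^ k)"
  proof -
    have "(1/2 + 2 * \<epsilon>\<^sup>2) ^ k = ((1 + 4 * \<epsilon>\<^sup>2) / 2) ^ k" by (simp add: field_simps)
    then show ?thesis by (simp add: power_divide power2_eq_square field_simps)
  qed
  also have "\<dots> \<le> 2 ^ k * (1 * exp (4 * real k * \<epsilon>\<^sup>2))"
  proof (intro mult_left_mono mult_mono)
    show "?r\<^sup>2 \<le> 1" using r1 by (intro power_le_one) auto
    have "(1 + 4 * \<epsilon>\<^sup>2) ^ k \<le> exp (4 * \<epsilon>\<^sup>2) ^ k"
      by (intro power_mono) auto
    also have "\<dots> = exp (4 * real k * \<epsilon>\<^sup>2)" by (simp add: exp_of_nat_mult[symmetric] mult_ac)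
    finally show "(1 + 4 * \<epsilon>\<^sup>2) ^ k \<le> exp (4 * real k * \<epsilon>\<^sup>2)" .
  qed auto
  finally have s2: "(\<Sum>w\<in>sign_words k. (?L w)\<^sup>2) \<le> 2 ^ k * exp (4 * real k * \<epsilon>\<^sup>2)" by simp
  have "(\<Sum>w\<in>sign_words k. \<bar>1 - ?L w\<bar>)\<^sup>2 \<le> (\<Sum>w\<in>sign_words k. (1 - ?L w)\<^sup>2) * 2 ^ k"
    using sum_squared_le_sum_of_squares[of "\<lambda>w. \<bar>1 - ?L w\<bar>" "sign_words k"] by simp
  also have "(\<Sum>w\<in>sign_words k. (1 - ?L w)\<^sup>2) =
      (\<Sum>w\<in>sign_words k. 1) - 2 * (\<Sum>w\<in>sign_words k. ?L w) + (\<Sum>w\<in>sign_words k. (?L w)\<^sup>2)"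
    by (simp add: power2_diff sum.distrib sum_subtractf sum_distrib_left)
  also have "\<dots> \<le> 2 ^ k * (1 - 2 * ?r + exp (4 * real k * \<epsilon>\<^sup>2))"
    using s2 unfolding s1 by (simp add: algebra_simps)
  finally have "(\<Sum>w\<in>sign_words k. \<bar>1 - ?L w\<bar>)\<^sup>2 \<le> (2 ^ k)\<^sup>2 * (1 - 2 * ?r + exp (4 * real k * \<epsilon>\<^sup>2))"
    by (simp add: power2_eq_square mult_ac)
  from real_le_rsqrt[OF this] show ?thesis by (simp add: real_sqrt_mult)
qed

section \<open>The fraction of words with a given count\<close>

definition count_frequency :: "nat set \<Rightarrow> nat \<Rightarrow> nat \<Rightarrow> (nat \<Rightarrow> int) \<Rightarrow> real" where
  "count_frequency J k n x = (\<Sum>w\<in>sign_words k. of_bool (window_count J k x w = n)) / 2 ^ k"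

lemma depends_on_count_frequency:
  assumes "\<And>j. j \<in> J \<Longrightarrow> {j..<j + k} \<subseteq> A"
  shows "depends_on (count_frequency J k n) A"
  unfolding count_frequency_def
  by (intro depends_on_comp[where h = "\<lambda>s. s / 2 ^ k"] depends_on_sum
        depends_on_comp[where h = "\<lambda>c. of_bool (c = n)"] depends_on_window_count assms)

text \<open>The Poisson approximation averaged over words. The bound 1/10 gives 1/2 + \<epsilon>
  \<le> 3/5: products of two word weights over 2^k starts cost 2^k (3/5)^(2k) = (18/25)^k, and pairs
  of matching windows cost (3/5)^k. Both stay below (3/4)^k, times the at most \<open>2 * k\<close>
  neighbours.\<close>

lemma expectation_count_frequency:
  assumes \<epsilon>: "\<And>n. m \<le> n \<Longrightarrow> \<bar>\<gamma> n\<bar> \<le> \<epsilon>" "\<epsilon> \<le> 1/10"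
    and J: "J \<subseteq> {m..2 ^ k}" "1 \<le> m" and k: "0 < k"
  shows "\<bar>expectation (count_frequency J k n) - 1 / (exp 1 * fact n)\<bar> \<le>
    exp 1 * sqrt (1 - 2 * (real (card J) / 2 ^ k) + exp (4 * real k * \<epsilon>\<^sup>2)) + 8 * exp 1 * (real k * (3/4) ^ k)"
proof -
  have finJ: "finite J" using J(1) by (rule finite_subset) simp
  have J1: "J \<subseteq> {1..}" using J by auto
  have Jm: "m \<le> j" if "j \<in> J" for j using J(1) that by auto
  have \<epsilon>0: "0 \<le> \<epsilon>" using \<epsilon>(1)[of m] by linarith
  have "card J \<le> card {1..2 ^ k :: nat}" using J by (intro card_mono) auto
  then have "card J \<le> 2 ^ k" by simp
  then have cardJ: "real (card J) \<le> 2 ^ k" by (metis of_nat_mono of_nat_numeral of_nat_power)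
  let ?N = "neighbours J k"
  let ?I = "\<lambda>j w x. of_bool (map x [j..<j + k] = w) :: real"
  let ?p = "\<lambda>j w. word_weight k j w"
  let ?P = "\<lambda>w. expectation (\<lambda>x. of_bool (window_count J k x w = n)) :: real"
  let ?\<pi> = "1 / (exp 1 * fact n) :: real"
  let ?D1 = "\<lambda>w. \<bar>1 - (\<Sum>j\<in>J. ?p j w)\<bar>"
  let ?A = "\<lambda>w. \<Sum>j\<in>J. \<Sum>i\<in>?N j. ?p j w * ?p i w"
  let ?B = "\<lambda>w. \<Sum>j\<in>J. \<Sum>i\<in>?N j - {j}. expectation (\<lambda>x. ?I j w x * ?I i w x)"
  have NJ: "i \<in> J" if "i \<in> ?N j" for i j using that neighbours_subset by blast
  have finN: "finite (?N j)" for j using finJ neighbours_subset by (rule finite_subset[rotated])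
  have cN: "real (card (?N j)) \<le> 2 * real k" for j
    using card_neighbours[of J k j] by (metis of_nat_le_iff of_nat_mult of_nat_numeral)
  have sumA: "(\<Sum>w\<in>sign_words k. ?A w) \<le> 2 ^ k * (2 * (real k * (3/4) ^ k))"
  proof -
    have "?A w \<le> 2 * (real k * (3/4) ^ k)" for w
    proof -
      have "?A w \<le> (\<Sum>j\<in>J. \<Sum>i\<in>?N j. (3/5) ^ k * (3/5) ^ k)"
      proof (intro sum_mono mult_mono word_weight_nonneg)
        have *: "?p j w \<le> (3/5) ^ k" if "j \<in> J" for j
        proof -
          have "?p j w \<le> (1/2 + \<epsilon>) ^ k" using that J by (intro word_weight_le[OF \<epsilon>(1)]) auto
          also have "\<dots> \<le> (3/5) ^ k" using \<epsilon>(2) \<epsilon>0 by (intro power_mono) auto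
          finally show ?thesis .
        qed
        fix j i assume "j \<in> J" "i \<in> ?N j"
        then show "?p j w \<le> (3/5) ^ k" "?p i w \<le> (3/5) ^ k" using * NJ by auto
      qed auto
      also have "\<dots> = (\<Sum>j\<in>J. real (card (?N j)) * (9/25) ^ k)"
        by (simp add: power_mult_distrib[symmetric])
      also have "\<dots> \<le> (\<Sum>j\<in>J. (2 * real k) * (9/25) ^ k)"
        by (intro sum_mono mult_right_mono cN) auto
      also have "\<dots> = real (card J) * ((2 * real k) * (9/25) ^ k)" by simp
      also have "\<dots> \<le> 2 ^ k * ((2 * real k) * (9/25) ^ k)"
        by (intro mult_right_mono cardJ) auto
      also have "\<dots> = 2 * (real k * (18/25) ^ k)"
        by (simp add: mult_ac power_mult_distrib[symmetric])
      also have "\<dots> \<le> 2 * (real k * (3/4) ^ k)"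
        by (intro mult_left_mono power_mono) auto
      finally show ?thesis .
    qed
    then have "(\<Sum>w\<in>sign_words k. ?A w) \<le> (\<Sum>w\<in>sign_words k. 2 * (real k * (3/4) ^ k))"
      by (intro sum_mono)
    then show ?thesis by simp
  qed
  have sumB: "(\<Sum>w\<in>sign_words k. ?B w) \<le> 2 ^ k * (2 * (real k * (3/4) ^ k))"
  proof -
    have "(\<Sum>w\<in>sign_words k. ?B w) = (\<Sum>j\<in>J. \<Sum>i\<in>?N j - {j}. \<Sum>w\<in>sign_words k. expectation (\<lambda>x. ?I j w x * ?I i w x))"
      by (subst sum.swap, intro sum.cong refl, rule sum.swap)
    also have "\<dots> \<le> (\<Sum>j\<in>J. \<Sum>i\<in>?N j - {j}. (1/2 + \<epsilon>) ^ k)"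
      using J(2) by (intro sum_mono sum_expectation_two_windows_le[OF \<epsilon>(1)]) (auto intro: Jm NJ)
    also have "\<dots> \<le> (\<Sum>j\<in>J. real (card (?N j - {j})) * (3/4) ^ k)"
      using \<epsilon>0 \<epsilon>(2) by (auto intro!: sum_mono mult_left_mono power_mono)
    also have "\<dots> \<le> (\<Sum>j\<in>J. (2 * real k) * (3/4) ^ k)"
    proof (intro sum_mono mult_right_mono)
      fix j
      have "real (card (?N j - {j})) \<le> real (card (?N j))"
        using finN by (intro of_nat_mono card_mono) auto
      then show "real (card (?N j - {j})) \<le> 2 * real k" using cN[of j] by linarith
    qed auto
    also have "\<dots> = real (card J) * ((2 * real k) * (3/4) ^ k)" by simp
    also have "\<dots> \<le> 2 ^ k * ((2 * real k) * (3/4) ^ k)"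
      by (intro mult_right_mono cardJ) auto
    finally show ?thesis by (simp add: mult_ac)
  qed
  have iP: "integrable \<nu> (\<lambda>x. of_bool (window_count J k x w = n) :: real)" for w
  proof (rule integrable_depends_on)
    show "depends_on (\<lambda>x. of_bool (window_count J k x w = n) :: real) (\<Union>j\<in>J. {j..<j + k})"
      by (rule depends_on_comp[OF depends_on_window_count]) auto
  qed (use finJ J1 in auto)
  have E: "expectation (count_frequency J k n) = (\<Sum>w\<in>sign_words k. ?P w) / 2 ^ k"
    unfolding count_frequency_def
    by (subst integral_divide_zero, subst Bochner_Integration.integral_sum) (use iP in auto)
  have "(\<Sum>w\<in>sign_words k. ?P w - ?\<pi>) = (\<Sum>w\<in>sign_words k. ?P w) - 2 ^ k * ?\<pi>"
    by (simp add: sum_subtractf)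
  then have "2 ^ k * (expectation (count_frequency J k n) - ?\<pi>) = (\<Sum>w\<in>sign_words k. ?P w - ?\<pi>)"
    unfolding E by (simp add: right_diff_distrib)
  then have "2 ^ k * \<bar>expectation (count_frequency J k n) - ?\<pi>\<bar> = \<bar>\<Sum>w\<in>sign_words k. ?P w - ?\<pi>\<bar>"
    by (metis abs_mult abs_numeral power_abs)
  also have "\<dots> \<le> (\<Sum>w\<in>sign_words k. \<bar>?P w - ?\<pi>\<bar>)" by (rule sum_abs)
  also have "\<dots> \<le> (\<Sum>w\<in>sign_words k. exp 1 * ?D1 w + 2 * exp 1 * (?A w + ?B w))"
    using window_count_poisson_approximation[OF finJ J1 k]
    by (intro sum_mono) (simp only: sum.distrib)
  also have "\<dots> = exp 1 * (\<Sum>w\<in>sign_words k. ?D1 w) + 2 * exp 1 * ((\<Sum>w\<in>sign_words k. ?A w) + (\<Sum>w\<in>sign_words k. ?B w))"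
    unfolding sum.distrib sum_distrib_left[of "exp 1", symmetric] sum_distrib_left[of "2 * exp 1", symmetric] ..
  also have "\<dots> \<le> exp 1 * (2 ^ k * sqrt (1 - 2 * (real (card J) / 2 ^ k) + exp (4 * real k * \<epsilon>\<^sup>2)))
      + 2 * exp 1 * (2 ^ k * (2 * (real k * (3/4) ^ k)) + 2 ^ k * (2 * (real k * (3/4) ^ k)))"
    by (intro add_mono mult_left_mono sumA sumB sum_abs_mean_count_le[OF \<epsilon>(1) J]) auto
  also have "\<dots> = 2 ^ k * (exp 1 * sqrt (1 - 2 * (real (card J) / 2 ^ k) + exp (4 * real k * \<epsilon>\<^sup>2)) + 8 * exp 1 * (real k * (3/4) ^ k))"
    by (simp add: algebra_simps)
  finally show ?thesis by (simp only: mult_le_cancel_left_pos zero_less_power zero_less_numeral)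
qed

text \<open>A coordinate lies in at most \<open>k\<close> windows, so flipping it affects only the
  words they spell before and after, at most \<open>2 * k\<close>. Efron--Stein over fewer than 2 *
  2^k coordinates gives the bound.\<close>

lemma variance_count_frequency:
  assumes J: "J \<subseteq> {1..2 ^ k}" and k: "0 < k"
  shows "variance (count_frequency J k n) \<le> 8 * ((real k)\<^sup>2 * (1/2) ^ k)"
proof -
  have finJ: "finite J" using J by (rule finite_subset) simp
  let ?A = "{1..<2 ^ k + k}"
  have "variance (count_frequency J k n) \<le> real (card ?A) * (2 * real k / 2 ^ k)\<^sup>2"
  proof (rule variance_bounded_differences)
    show "depends_on (count_frequency J k n) ?A"
      by (rule depends_on_count_frequency) (use J in auto)
    fix a :: nat and x :: "nat \<Rightarrow> int" and u v :: int
    define y where "y = x(a := u)"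
    define z where "z = x(a := v)"
    \<comment> \<open>The starts of windows through \<open>a\<close>. Truncated subtraction may add
      start 0 for small \<open>a\<close>, but there are still at most \<open>k\<close> of
      them.\<close>
    define K where "K = {a + 1 - k..a}"
    define V where "V = (\<lambda>j. map y [j..<j + k]) ` K \<union> (\<lambda>j. map z [j..<j + k]) ` K"
    have "card V \<le> card K + card K"
      unfolding V_def by (intro order_trans[OF card_Un_le] add_mono card_image_le) (auto simp: K_def)
    also have "\<dots> \<le> 2 * k" using k by (auto simp: K_def)
    finally have cV: "card V \<le> 2 * k" .
    have same: "window_count J k y w = window_count J k z w" if w: "w \<notin> V" for w
    proof -
      have "map y [j..<j + k] = w \<longleftrightarrow> map z [j..<j + k] = w" for j
      proof (cases "j \<in> K")
        case True
        then show ?thesis using w by (auto simp: V_def)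
      next
        case False
        then have "b \<noteq> a" if "b \<in> {j..<j + k}" for b using that by (auto simp: K_def)
        then have "map y [j..<j + k] = map z [j..<j + k]"
          by (simp add: y_def z_def map_eq_conv)
        then show ?thesis by (simp only:)
      qed
      then show ?thesis unfolding window_count_def by simp
    qed
    have "count_frequency J k n y - count_frequency J k n z =
       (\<Sum>w\<in>sign_words k. of_bool (window_count J k y w = n) - of_bool (window_count J k z w = n)) / 2 ^ k"
      by (simp add: count_frequency_def sum_subtractf diff_divide_distrib)
    also have "\<bar>\<dots>\<bar> \<le> (\<Sum>w\<in>sign_words k. of_bool (w \<in> V)) / 2 ^ k"
      unfolding abs_divide power_abs abs_numeral
    proof (intro divide_right_mono order_trans[OF sum_abs] sum_mono)
      fix w show "\<bar>of_bool (window_count J k y w = n) - of_bool (window_count J k z w = n)\<bar> \<le> (of_bool (w \<in> V) :: real)"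
        using same[of w] by auto
    qed simp
    also have "(\<Sum>w\<in>sign_words k. of_bool (w \<in> V)) = real (card (sign_words k \<inter> V))"
      by (simp add: of_bool_def sum.If_cases Int_def)
    also have "card (sign_words k \<inter> V) \<le> card V"
      by (rule card_mono) (auto simp: V_def K_def)
    also note cV
    finally show "\<bar>count_frequency J k n (x(a := u)) - count_frequency J k n (x(a := v))\<bar> \<le> 2 * real k / 2 ^ k"
      unfolding y_def[symmetric] z_def[symmetric] by (simp add: divide_right_mono)
  qed auto
  also have "\<dots> \<le> (2 * 2 ^ k) * (2 * real k / 2 ^ k)\<^sup>2"
  proof (rule mult_right_mono)
    have "card ?A \<le> 2 * 2 ^ k"
      using less_exp[of k] unfolding card_atLeastLessThan by linarith
    then show "real (card ?A) \<le> 2 * 2 ^ k"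
      by (metis of_nat_mono of_nat_mult of_nat_numeral of_nat_power)
  qed simp
  also have "\<dots> = 8 * ((real k)\<^sup>2 * (1/2) ^ k)"
    by (simp add: power_divide power2_eq_square)
  finally show ?thesis .
qed

section \<open>Discarding early windows and almost sure Poisson limits\<close>

text \<open>Dropping the starts below \<open>m\<close> changes the count only of words spelled
  there, and these are fewer than \<open>m\<close>.\<close>

lemma prob_occurrences_approx:
  assumes "1 \<le> m" "m \<le> 2 ^ k"
  shows "\<bar>measure_pmf.prob (pmf_of_set (sign_words k)) {w. occurrences x k w = n}
     - count_frequency {m..2 ^ k} k n x\<bar> \<le> real m / 2 ^ k"
proof -
  let ?V = "(\<lambda>j. map x [j..<j + k]) ` {1..<m}"
  have same: "occurrences x k w = window_count {m..2 ^ k} k x w" if "w \<notin> ?V" for w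
  proof -
    have "{1..2 ^ k} = {1..<m} \<union> {m..2 ^ k}" using assms by auto
    moreover have "window_count {1..<m} k x w = 0"
      using that by (auto simp: window_count_def)
    ultimately show ?thesis
      unfolding occurrences_eq_window_count by (simp only:) (subst window_count_Un, auto)
  qed
  have "measure_pmf.prob (pmf_of_set (sign_words k)) {w. occurrences x k w = n} =
      (\<Sum>w\<in>sign_words k. of_bool (occurrences x k w = n)) / 2 ^ k"
    unfolding prob_sign_words by (simp add: of_bool_def sum.If_cases)
  then have "measure_pmf.prob (pmf_of_set (sign_words k)) {w. occurrences x k w = n} - count_frequency {m..2 ^ k} k n x =
     (\<Sum>w\<in>sign_words k. of_bool (occurrences x k w = n) - of_bool (window_count {m..2 ^ k} k x w = n)) / 2 ^ k"
    by (simp add: count_frequency_def sum_subtractf diff_divide_distrib)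
  also have "\<bar>\<dots>\<bar> \<le> (\<Sum>w\<in>sign_words k. of_bool (w \<in> ?V)) / 2 ^ k"
    unfolding abs_divide power_abs abs_numeral
  proof (intro divide_right_mono order_trans[OF sum_abs] sum_mono)
    fix w show "\<bar>of_bool (occurrences x k w = n) - of_bool (window_count {m..2 ^ k} k x w = n)\<bar> \<le> (of_bool (w \<in> ?V) :: real)"
    proof (cases "w \<in> ?V")
      case False
      then show ?thesis by (simp add: same[OF False])
    qed (auto simp: of_bool_def)
  qed simp
  also have "(\<Sum>w\<in>sign_words k. of_bool (w \<in> ?V)) = real (card (sign_words k \<inter> ?V))"
    by (simp add: of_bool_def sum.If_cases Int_def)
  also have "card (sign_words k \<inter> ?V) \<le> card ?V"
    by (rule card_mono) auto
  also have "card ?V \<le> card {1..<m}"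
    by (rule card_image_le) simp
  also have "\<dots> \<le> m" by simp
  finally show ?thesis by (simp add: divide_right_mono)
qed

text \<open>The cutoff 2^(k div 2) is negligible against 2^k, yet its logarithm is of order
  \<open>k\<close>. The limit combines three errors: early windows, fluctuation around the mean, and
  the distance of the mean from the Poisson value.\<close>

theorem AE_simply_poisson_generic:
  assumes small: "\<forall>\<^sub>F k in sequentially. \<forall>n\<ge>2 ^ (k div 2). \<bar>\<gamma> n\<bar> \<le> \<epsilon> k"
    and rate: "(\<lambda>k. real k * (\<epsilon> k)\<^sup>2) \<longlonglongrightarrow> 0"
  shows "AE x in \<nu>. simply_poisson_generic x"
proof -
  define m :: "nat \<Rightarrow> nat" where "m k = 2 ^ (k div 2)" for k
  define J where "J k = {m k..2 ^ k}" for k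
  have m1: "1 \<le> m k" and mk: "m k \<le> 2 ^ k" for k
    by (auto simp: m_def intro: power_increasing)
  have m_rate: "(\<lambda>k. real (m k) / 2 ^ k) \<longlonglongrightarrow> 0"
  proof -
    have "real (m k) / 2 ^ k = (1/2) ^ (k - k div 2)" for k
      by (simp add: m_def power_diff power_one_over)
    moreover have "filterlim (\<lambda>k :: nat. k - k div 2) at_top sequentially"
      unfolding filterlim_at_top
    proof
      fix Z :: nat
      show "\<forall>\<^sub>F k in sequentially. Z \<le> k - k div 2"
        using eventually_ge_at_top[of "2 * Z"] by eventually_elim linarith
    qed
    ultimately show ?thesis
      using filterlim_compose[OF LIMSEQ_realpow_zero[of "1/2"]] by simp
  qed
  have mean: "(\<lambda>k. expectation (count_frequency (J k) k n)) \<longlonglongrightarrow> 1 / (exp 1 * fact n)" for n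
  proof -
    \<comment> \<open>The error bound with \<open>card (J k)\<close> replaced by its lower bound
      \<open>2 ^ k - m k\<close>.\<close>
    let ?b = "\<lambda>k. exp 1 * sqrt (2 * (real (m k) / 2 ^ k) - 1 + exp (4 * (real k * (\<epsilon> k)\<^sup>2)))
      + 8 * exp 1 * (real k * (3/4) ^ k)"
    have "?b \<longlonglongrightarrow> exp 1 * sqrt (2 * 0 - 1 + exp (4 * 0)) + 8 * exp 1 * 0"
      using powser_times_n_limit_0[of "3/4 :: real"]
      by (intro tendsto_intros m_rate rate) simp
    then have b: "?b \<longlonglongrightarrow> 0" by simp
    have "(\<lambda>k. expectation (count_frequency (J k) k n) - 1 / (exp 1 * fact n)) \<longlonglongrightarrow> 0"
    proof (rule Lim_null_comparison[OF _ b])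
      \<comment> \<open>With \<open>k \<ge> 1\<close> this forces
        \<open>\<epsilon> k \<le> 1/10\<close>.\<close>
      have "\<forall>\<^sub>F k in sequentially. real k * (\<epsilon> k)\<^sup>2 < 1/100"
        using rate by (rule order_tendstoD) simp
      then show "\<forall>\<^sub>F k in sequentially. norm (expectation (count_frequency (J k) k n) - 1 / (exp 1 * fact n)) \<le> ?b k"
        using small eventually_gt_at_top[of 0]
      proof eventually_elim
        case (elim k)
        have "1 * (\<epsilon> k)\<^sup>2 \<le> real k * (\<epsilon> k)\<^sup>2" using elim(3) by (intro mult_right_mono) auto
        then have "(\<epsilon> k)\<^sup>2 \<le> (1/10)\<^sup>2" using elim(1) by (simp add: power2_eq_square)
        then have "\<epsilon> k \<le> 1/10" by (rule power2_le_imp_le) simp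
        moreover have "\<bar>\<gamma> i\<bar> \<le> \<epsilon> k" if "m k \<le> i" for i using elim(2) that by (simp add: m_def)
        ultimately have "\<bar>expectation (count_frequency (J k) k n) - 1 / (exp 1 * fact n)\<bar> \<le>
          exp 1 * sqrt (1 - 2 * (real (card (J k)) / 2 ^ k) + exp (4 * real k * (\<epsilon> k)\<^sup>2)) + 8 * exp 1 * (real k * (3/4) ^ k)"
          using elim(3) m1 by (intro expectation_count_frequency[of "m k"]) (auto simp: J_def)
        also have "\<dots> \<le> ?b k"
        proof -
          have "2 ^ k \<le> card (J k) + m k" using mk[of k] by (simp add: J_def)
          then have "2 ^ k \<le> real (card (J k)) + real (m k)"
            by (metis of_nat_add of_nat_mono of_nat_numeral of_nat_power)
          then have "2 ^ k / 2 ^ k \<le> (real (card (J k)) + real (m k)) / 2 ^ k"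
            by (rule divide_right_mono) simp
          then have "1 - real (m k) / 2 ^ k \<le> real (card (J k)) / 2 ^ k"
            by (simp add: add_divide_distrib)
          then show ?thesis by (auto intro!: mult_left_mono simp: mult.assoc)
        qed
        finally show ?case by simp
      qed
    qed
    then show ?thesis by (simp add: LIM_zero_iff)
  qed
  have concentration: "AE x in \<nu>. (\<lambda>k. (count_frequency (J k) k n x - expectation (count_frequency (J k) k n))\<^sup>2) \<longlonglongrightarrow> 0" for n
  proof (rule AE_tendsto_zero_of_summable_integral)
    have d: "depends_on (count_frequency (J k) k n) {1..<2 ^ k + k}" for k
      by (rule depends_on_count_frequency) (use m1[of k] in \<open>auto simp: J_def\<close>)
    show "integrable \<nu> (\<lambda>x. (count_frequency (J k) k n x - expectation (count_frequency (J k) k n))\<^sup>2)" for k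
      by (rule integrable_depends_on[OF _ _ depends_on_comp[OF d]]) auto
    have "summable (\<lambda>k. (real k)\<^sup>2 * (1/2) ^ k)"
    \<comment> \<open>From \<open>k = 5\<close> on, (k+1)^2 \<le> 3/2 k^2, so the ratio of
      consecutive terms is at most 3/4.\<close>
    proof (rule summable_ratio_test[of "3/4" 5])
      fix k :: nat assume k: "5 \<le> k"
      have "5 * real k \<le> real k * real k" using k by (intro mult_right_mono) auto
      moreover have "5 \<le> real k" using k by simp
      ultimately have "2 + real k * 4 \<le> real k * real k" by linarith
      then have "(real (Suc k))\<^sup>2 \<le> 3/2 * (real k)\<^sup>2" using k by (simp add: power2_eq_square algebra_simps)
      then have "(real (Suc k))\<^sup>2 * (1/2) ^ Suc k \<le> 3/2 * (real k)\<^sup>2 * (1/2) ^ Suc k"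
        by (intro mult_right_mono) auto
      then show "norm ((real (Suc k))\<^sup>2 * (1/2) ^ Suc k) \<le> 3/4 * norm ((real k)\<^sup>2 * (1/2) ^ k)"
        by (simp add: abs_mult)
    qed simp
    then have "summable (\<lambda>k. 8 * ((real k)\<^sup>2 * (1/2) ^ k))" by (rule summable_mult)
    then show "summable (\<lambda>k. variance (count_frequency (J k) k n))"
    proof (rule summable_comparison_test'[of _ 1])
      fix k :: nat assume "1 \<le> k"
      then have "variance (count_frequency (J k) k n) \<le> 8 * ((real k)\<^sup>2 * (1/2) ^ k)"
        using m1[of k] by (intro variance_count_frequency) (auto simp: J_def)
      then show "norm (variance (count_frequency (J k) k n)) \<le> 8 * ((real k)\<^sup>2 * (1/2) ^ k)"
        by (simp add: integral_nonneg_AE)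
    qed
  qed simp
  \<comment> \<open>Countably many values of \<open>n\<close> share one null set.\<close>
  have "AE x in \<nu>. \<forall>n. (\<lambda>k. (count_frequency (J k) k n x - expectation (count_frequency (J k) k n))\<^sup>2) \<longlonglongrightarrow> 0"
    unfolding AE_all_countable using concentration by blast
  then show ?thesis
  proof eventually_elim
    case (elim x)
    show ?case unfolding simply_poisson_generic_def
    proof
      fix n
      let ?q = "\<lambda>k. measure_pmf.prob (pmf_of_set (sign_words k)) {w. occurrences x k w = n}"
      let ?F = "\<lambda>k. count_frequency (J k) k n x"
      let ?E = "\<lambda>k. expectation (count_frequency (J k) k n)"
      have "(\<lambda>k. sqrt ((?F k - ?E k)\<^sup>2)) \<longlonglongrightarrow> sqrt 0"
        using elim by (intro tendsto_real_sqrt) blast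
      then have 1: "(\<lambda>k. ?F k - ?E k) \<longlonglongrightarrow> 0"
        by (simp add: tendsto_rabs_zero_iff)
      have 2: "(\<lambda>k. ?q k - ?F k) \<longlonglongrightarrow> 0"
        by (rule Lim_null_comparison[OF _ m_rate])
           (use prob_occurrences_approx[OF m1 mk] in \<open>simp add: J_def\<close>)
      from tendsto_add[OF tendsto_add[OF 2 1] mean[of n]]
      show "?q \<longlonglongrightarrow> 1 / (exp 1 * fact n)" by simp
    qed
  qed
qed

end

section \<open>The two decay regimes\<close>

theorem theorem1p1:
  fixes \<gamma> :: "nat \<Rightarrow> real"
  assumes "\<And>n. n \<ge> 1 \<Longrightarrow> \<gamma> n \<in> {-1/2<..<1/2}"
  shows "((\<exists>\<delta>>0. \<gamma> \<in> O(\<lambda>n. ln (real n) powr (- (1/2 + \<delta>)))) \<longrightarrow>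
            (AE x in sign_product \<gamma>. simply_poisson_generic x)) \<and>
         ((\<exists>\<delta>>0. \<forall>\<^sub>F n in sequentially. \<gamma> n = ln (real n) powr (- (1/2 - \<delta>))) \<longrightarrow>
            (AE x in sign_product \<gamma>. \<not> simply_poisson_generic x))"
proof -
  \<comment> \<open>The hypothesis says nothing about the unused value \<open>\<gamma> 0\<close>, so it is reset.\<close>
  define \<gamma>' where "\<gamma>' = \<gamma>(0 := 0)"
  have eq: "\<gamma>' n = \<gamma> n" if "1 \<le> n" for n using that by (simp add: \<gamma>'_def)
  interpret sign_bias \<gamma>'
  proof
    fix n show "\<bar>\<gamma>' n\<bar> < 1/2"
      using assms[of n] by (cases "n = 0") (auto simp: \<gamma>'_def)
  qed
  have \<nu>: "sign_product \<gamma> = \<nu>"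
    unfolding sign_product_def by (rule PiM_cong) (auto simp: eq)
  show ?thesis unfolding \<nu>
  proof (intro conjI impI; elim exE conjE)
    fix \<delta> :: real
    assume \<delta>: "0 < \<delta>" and O: "\<gamma> \<in> O(\<lambda>n. ln (real n) powr (- (1/2 + \<delta>)))"
    from O obtain c where c: "c > 0" "\<forall>\<^sub>F n in sequentially. norm (\<gamma> n) \<le> c * norm (ln (real n) powr (- (1/2 + \<delta>)))"
      by (rule landau_o.bigE)
    from c(2) obtain N where N: "\<And>n. N \<le> n \<Longrightarrow> \<bar>\<gamma> n\<bar> \<le> c * ln (real n) powr (- (1/2 + \<delta>))"
      unfolding eventually_sequentially by auto
    \<comment> \<open>The logarithm of the cutoff 2^(k div 2), the smallest \<open>ln n\<close> that
      occurs beyond it.\<close>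
    define L where "L k = real (k div 2) * ln 2" for k
    have div2: "filterlim (\<lambda>k :: nat. k div 2) at_top sequentially"
      unfolding filterlim_at_top
    proof
      fix Z :: nat
      show "\<forall>\<^sub>F k in sequentially. Z \<le> k div 2"
        using eventually_ge_at_top[of "2 * Z"] by eventually_elim linarith
    qed
    have L_top: "filterlim L at_top sequentially"
      unfolding L_def
      by (intro filterlim_at_top_mult_tendsto_pos[OF tendsto_const] filterlim_compose[OF filterlim_real_sequentially div2]) simp
    show "AE x in \<nu>. simply_poisson_generic x"
    proof (rule AE_simply_poisson_generic)
      show "\<forall>\<^sub>F k in sequentially. \<forall>n\<ge>2 ^ (k div 2). \<bar>\<gamma>' n\<bar> \<le> c * L k powr (- (1/2 + \<delta>))"
        \<comment> \<open>Then \<open>k div 2\<close> is at least \<open>N\<close> and at least 1,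
          so 2^(k div 2) exceeds \<open>N\<close> and \<open>L k\<close> is positive.\<close>
        using eventually_ge_at_top[of "2 * N + 2"]
      proof eventually_elim
        case (elim k)
        show ?case
        proof (intro allI impI)
          fix n :: nat assume n: "2 ^ (k div 2) \<le> n"
          have "N \<le> k div 2" "1 \<le> k div 2" using elim by linarith+
          then have "N \<le> n" "1 \<le> n" using n less_exp[of "k div 2"] by linarith+
          have "2 ^ (k div 2) \<le> real n" using n by (metis of_nat_mono of_nat_numeral of_nat_power)
          then have "ln (2 ^ (k div 2)) \<le> ln (real n)" using \<open>1 \<le> n\<close> by (subst ln_le_cancel_iff) auto
          then have "L k \<le> ln (real n)" by (simp add: L_def ln_realpow)
          moreover have "0 < L k" using \<open>1 \<le> k div 2\<close> by (simp add: L_def)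
          ultimately have "ln (real n) powr (- (1/2 + \<delta>)) \<le> L k powr (- (1/2 + \<delta>))"
            using \<delta> by (intro powr_mono2') auto
          then have "c * ln (real n) powr (- (1/2 + \<delta>)) \<le> c * L k powr (- (1/2 + \<delta>))"
            using c(1) by (intro mult_left_mono) auto
          then show "\<bar>\<gamma>' n\<bar> \<le> c * L k powr (- (1/2 + \<delta>))"
            using N[OF \<open>N \<le> n\<close>] eq[OF \<open>1 \<le> n\<close>] by simp
        qed
      qed
      show "(\<lambda>k. real k * (c * L k powr (- (1/2 + \<delta>)))\<^sup>2) \<longlonglongrightarrow> 0"
      proof (rule tendsto_sandwich[OF _ _ tendsto_const])
        show "\<forall>\<^sub>F k in sequentially. 0 \<le> real k * (c * L k powr (- (1/2 + \<delta>)))\<^sup>2" by simp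
        \<comment> \<open>Squaring gives the exponent -1 - 2\<delta>. Since k \<le> 3 (k div 2) for
          k \<ge> 2, the factor \<open>k\<close> costs only a multiple of \<open>L k\<close>, which
          leaves the exponent -2\<delta>.\<close>
        show "\<forall>\<^sub>F k in sequentially. real k * (c * L k powr (- (1/2 + \<delta>)))\<^sup>2 \<le> 3 * c\<^sup>2 / ln 2 * L k powr (- (2 * \<delta>))"
          using eventually_ge_at_top[of 2]
        proof eventually_elim
          case (elim k)
          have L: "0 < L k" using elim by (auto simp: L_def)
          have "k \<le> 3 * (k div 2)" using elim by linarith
          then have "real k \<le> 3 * real (k div 2)" by linarith
          also have "\<dots> = 3 / ln 2 * L k" by (simp add: L_def)
          finally have k: "real k \<le> 3 / ln 2 * L k" .
          have "(L k powr (- (1/2 + \<delta>)))\<^sup>2 = L k powr (- (2 * \<delta>)) / L k"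
          proof -
            have "(L k powr (- (1/2 + \<delta>)))\<^sup>2 = L k powr (- (2 * \<delta>) - 1)"
              by (simp add: power2_eq_square powr_add[symmetric] algebra_simps)
            then show ?thesis using L by (simp add: powr_diff)
          qed
          then have "real k * (c * L k powr (- (1/2 + \<delta>)))\<^sup>2 = real k * (c\<^sup>2 * (L k powr (- (2 * \<delta>)) / L k))"
            by (simp only: power_mult_distrib)
          also have "\<dots> \<le> 3 / ln 2 * L k * (c\<^sup>2 * (L k powr (- (2 * \<delta>)) / L k))"
            using L by (intro mult_right_mono k) auto
          also have "\<dots> = 3 * c\<^sup>2 / ln 2 * L k powr (- (2 * \<delta>))"
            using L by simp
          finally show ?case .
        qed
        have "(\<lambda>k. L k powr (- (2 * \<delta>))) \<longlonglongrightarrow> 0"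
          using \<delta> L_top by (intro tendsto_neg_powr) auto
        from tendsto_mult[OF tendsto_const this]
        show "(\<lambda>k. 3 * c\<^sup>2 / ln 2 * L k powr (- (2 * \<delta>))) \<longlonglongrightarrow> 0" by simp
      qed
    qed
  next
    fix \<delta> :: real
    assume \<delta>: "0 < \<delta>" and ev: "\<forall>\<^sub>F n in sequentially. \<gamma> n = ln (real n) powr (- (1/2 - \<delta>))"
    have "\<forall>\<^sub>F n in sequentially. \<gamma>' n = ln (real n) powr (- (1/2 - \<delta>))"
      using ev eventually_ge_at_top[of 1] by eventually_elim (simp add: eq)
    with \<delta> show "AE x in \<nu>. \<not> simply_poisson_generic x"
      by (rule AE_not_simply_poisson_generic)
  qed
qed

end
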